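(* Let $X$ be a $T_3$ topological space such that there is no strongly inaccessible cardinal $\kappa$ with $\kappa\le |X|$ (i.e. $|X|$ is less than the first strongly inaccessible cardinal, if one exists). Then $X$ has a Noetherian base.
   Context: A partially ordered set is Noetherian if it contains no infinite strictly increasing sequence. A base $\mathcal B$ of a topological space is a Noetherian base if the poset $\langle \mathcal B,\subseteq\rangle$ is Noetherian, i.e. $\mathcal B$ contains no infinite strictly $\subseteq$-increasing sequence. A cardinal is strongly inaccessible if it is uncountable, regular and a strong limit. *)

theory Defs
  imports "HOL-Analysis.Analysis"
begin

unbundle cardinal_syntax

definition T3_space :: "'a topology \<Rightarrow> bool" where
  "T3_space X \<equiv> t1_space X \<and> regular_space X"

definition is_base :: "'a topology \<Rightarrow> 'a set set \<Rightarrow> bool" where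
  "is_base X \<B> \<equiv> (\<forall>V\<in>\<B>. openin X V) \<and> (\<forall>U. openin X U \<longrightarrow> (\<exists>\<C>\<subseteq>\<B>. \<Union>\<C> = U))"

definition noetherian_family :: "'a set set \<Rightarrow> bool" where
  "noetherian_family \<B> \<equiv> \<not> (\<exists>f :: nat \<Rightarrow> 'a set. (\<forall>n. f n \<in> \<B>) \<and> (\<forall>n. f n \<subset> f (Suc n)))"

definition noetherian_base :: "'a topology \<Rightarrow> 'a set set \<Rightarrow> bool" where
  "noetherian_base X \<B> \<equiv> is_base X \<B> \<and> noetherian_family \<B>"

text \<open>The cardinal |A| is strongly inaccessible: uncountable, regular, strong limit.
  Every cardinal below |A| is the cardinality of some subset of A.\<close>
definition strongly_inaccessible_card :: "'a set \<Rightarrow> bool" where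
  "strongly_inaccessible_card A \<equiv>
     \<not> countable A \<and> regularCard (card_of A) \<and>
     (\<forall>B\<subseteq>A. card_of B <o card_of A \<longrightarrow> card_of (Pow B) <o card_of A)"

end

theory Submission
  imports Defs
begin

text \<open>
  Call \<open>S \<subseteq> Y \<times> Pow X\<close> a system for \<open>Y\<close> if the \<open>V\<close> with \<open>(x, V) \<in> S\<close> form a local base at every
  \<open>x \<in> Y\<close>, and call \<open>Y\<close> good if it has a system whose open sets form a Noetherian family; the theorem
  says that the whole space is good. A point is rich for an index set \<open>C\<close> if arbitrarily close to it
  there are open sets \<open>H\<close>, with the point outside their closure, that contain a family of open sets
  indexed by \<open>C\<close> of which none is included in the closure of another. If all points of \<open>Y\<close> are rich
  for \<open>C\<close> and some system for \<open>Y\<close> splits into \<open>C\<close> many Noetherian classes, then \<open>Y\<close> is good: puncture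
  each \<open>V\<close> by a closed set that records its class.

  A maximal disjoint family of homogeneous open cells \<open>G d\<close> supplies both richness and codes. In each
  cell that is not a point, every open set contains such an antichain as large as the algebra of
  regular open subsets of the cell. A regular open set \<open>V\<close> is determined by the set \<open>J V\<close> of
  the cells that it meets and by its traces on them, and open sets that meet \<open>|T|\<close> many cells have
  antichains indexed by \<open>Pow T\<close>. Moreover, the sets of size at most \<open>|T|\<close> can be coloured by \<open>Pow T\<close> so
  that sets of equal colour are never properly included in each other.

  Goodness then follows by induction on \<open>|T|\<close> for the set of points at which \<open>T\<close> bounds the number
  of cells. This is where inaccessible cardinals enter: unless \<open>|T|\<close> is strongly inaccessible, the
  points already treated at smaller cardinals form a union of at most \<open>|Pow S|\<close> good sets for some
  \<open>|S| < |T|\<close>.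
\<close>

section \<open>Cardinals and antichain colourings\<close>

lemma card_le_injE:
  assumes "|A| \<le>o |B|"
  obtains f where "inj_on f A" "f ` A \<subseteq> B"
  using assms card_of_ordLeq[of A B] by auto

lemma card_eq_bijE:
  assumes "|A| =o |B|"
  obtains f where "bij_betw f A B"
  using assms card_of_ordIso[of A B] by auto

lemma ordIso_of_antisym: "|A| \<le>o |B| \<Longrightarrow> |B| \<le>o |A| \<Longrightarrow> |A| =o |B|"
  using ordIso_iff_ordLeq by blast

lemma card_less_or_le: "|A| <o |B| \<or> |B| \<le>o |A|"
  using not_ordLess_iff_ordLeq[OF card_of_Well_order card_of_Well_order] by blast

lemma minimal_card_exists:
  assumes "F \<noteq> {}"
  shows "\<exists>A\<in>F. \<forall>B\<in>F. |A| \<le>o |B|"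
proof -
  obtain r where r: "r \<in> card_of ` F" "\<forall>r' \<in> card_of ` F. r \<le>o r'"
    using exists_minim_Card_order[of "card_of ` F"] assms card_of_Card_order by blast
  obtain A where "A \<in> F" "r = |A|" using r(1) by blast
  with r(2) show ?thesis by blast
qed

lemma subset_of_card:
  assumes "|A| \<le>o |B|"
  obtains B' where "B' \<subseteq> B" "|B'| =o |A|"
proof -
  obtain f where f: "inj_on f A" "f ` A \<subseteq> B" using assms by (rule card_le_injE)
  have "|A| =o |f ` A|" using card_of_ordIsoI[of f A "f ` A"] f(1) by (simp add: bij_betw_def)
  then show thesis using that[of "f ` A"] f(2) ordIso_symmetric by blast
qed

lemma infinite_pairing:
  assumes "infinite T"
  obtains pr where "inj_on pr (T \<times> T)" "\<And>a b. a \<in> T \<Longrightarrow> b \<in> T \<Longrightarrow> pr (a, b) \<in> T"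
proof -
  have "|T \<times> T| \<le>o |T|" using card_of_Times_same_infinite[OF assms] ordIso_iff_ordLeq by blast
  then obtain pr where "inj_on pr (T \<times> T)" "pr ` (T \<times> T) \<subseteq> T" by (rule card_le_injE)
  then show thesis using that by blast
qed

lemma infinite_doubling:
  assumes "infinite T" "|T| \<le>o |J|"
  obtains i where "inj_on i (T \<times> (UNIV::bool set))" "i ` (T \<times> UNIV) \<subseteq> J"
proof -
  have "infinite J" using card_of_ordLeq_infinite assms by blast
  have "|T \<times> (UNIV::bool set)| \<le>o |T \<times> T|"
    by (rule card_of_Times_mono2, rule ordLess_imp_ordLeq,
        rule finite_ordLess_infinite[OF card_of_Well_order card_of_Well_order])
      (simp_all add: Field_card_of assms(1))
  moreover have "|T \<times> T| =o |T|" using card_of_Times_same_infinite[OF assms(1)] .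
  ultimately have "|T \<times> (UNIV::bool set)| \<le>o |J|"
    using assms(2) ordLeq_ordIso_trans ordLeq_transitive by blast
  then show thesis using that by (rule card_le_injE)
qed

text \<open>A well-ordered set cannot be mapped monotonically into a proper initial part of itself, so an
  order isomorphism of \<^term>\<open>B\<close> onto a subset \<^term>\<open>A\<close> makes \<^term>\<open>A\<close> cofinal in \<^term>\<open>B\<close>.\<close>

lemma order_embedding_inflationary:
  assumes r: "Well_order r" and B: "B \<subseteq> Field r"
    and f: "f ` B \<subseteq> B" "\<And>x y. x \<in> B \<Longrightarrow> y \<in> B \<Longrightarrow> (x, y) \<in> r \<Longrightarrow> (f x, f y) \<in> r" "inj_on f B"
    and b: "b \<in> B"
  shows "(b, f b) \<in> r"
  using b
proof (induction b rule: wf_induct[of "r - Id"])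
  case 1
  show ?case using r by (simp add: well_order_on_def)
next
  case (2 b)
  show ?case
  proof (rule ccontr)
    assume n: "(b, f b) \<notin> r"
    have fb: "f b \<in> B" using f(1) 2(2) by blast
    have tot: "Total r" using r by (simp add: well_order_on_def linear_order_on_def)
    have an: "antisym r" using r by (simp add: well_order_on_def linear_order_on_def partial_order_on_def)
    have re: "Refl r" using r by (simp add: well_order_on_def linear_order_on_def partial_order_on_def preorder_on_def)
    have "f b \<noteq> b" using n re B 2(2) by (metis refl_onD subsetD)
    then have lt: "(f b, b) \<in> r - Id"
      using n tot fb 2(2) B unfolding total_on_def by blast
    have "(f b, f (f b)) \<in> r" using 2(1) lt fb by blast
    moreover have "(f (f b), f b) \<in> r" using f(2)[OF fb 2(2)] lt by blast
    ultimately have "f (f b) = f b" using an by (simp add: antisym_def)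
    then have "f b = b" using f(3) fb 2(2) by (simp add: inj_on_def)
    then show False using lt by simp
  qed
qed

section \<open>Colourings of small sets with antichain colour classes\<close>

definition antichain_colours :: "'a set \<Rightarrow> 'b set \<Rightarrow> ('b set \<Rightarrow> 'a set) \<Rightarrow> bool" where
  "antichain_colours T \<delta> c \<longleftrightarrow>
    (\<forall>A. A \<subseteq> \<delta> \<and> |A| \<le>o |T| \<longrightarrow> c A \<subseteq> T) \<and>
    (\<forall>A B. A \<subseteq> B \<and> B \<subseteq> \<delta> \<and> |B| \<le>o |T| \<and> c A = c B \<longrightarrow> A = B)"

lemma antichain_coloursD:
  assumes "antichain_colours T \<delta> c"
  shows "A \<subseteq> \<delta> \<Longrightarrow> |A| \<le>o |T| \<Longrightarrow> c A \<subseteq> T"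
    and "A \<subseteq> B \<Longrightarrow> B \<subseteq> \<delta> \<Longrightarrow> |B| \<le>o |T| \<Longrightarrow> c A = c B \<Longrightarrow> A = B"
  using assms unfolding antichain_colours_def by blast+

text \<open>Colourings are built by induction on initial segments \<open>\<delta>\<close> of a well-order. If \<open>\<delta>\<close> has a cofinal
  subset \<open>K\<close> of size at most \<open>|T|\<close>, the colour of \<open>A\<close> records the colours of its traces below the
  members of \<open>K\<close>. Otherwise \<open>A\<close> is bounded, and its colour records its order type and the colour
  belonging to its least strict bound; sets \<open>A \<subseteq> B\<close> of the same order type have the same bounds.\<close>

lemma antichain_colours_cofinal:
  assumes T: "infinite T" and r: "Well_order r"
    and K: "K \<subseteq> \<delta>" "|K| \<le>o |T|" "\<And>x. x \<in> \<delta> \<Longrightarrow> \<exists>k\<in>K. (x, k) \<in> r"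
    and IH: "\<And>a. a \<in> \<delta> \<Longrightarrow> antichain_colours T (underS r a) (C a)"
  shows "\<exists>c. antichain_colours T \<delta> c"
proof -
  obtain pr where pr: "inj_on pr (T \<times> T)" "\<And>a b. a \<in> T \<Longrightarrow> b \<in> T \<Longrightarrow> pr (a, b) \<in> T"
    using infinite_pairing[OF T] by blast
  have pr_eq: "pr (a, b) = pr (a', b') \<longleftrightarrow> a = a' \<and> b = b'"
    if "a \<in> T" "b \<in> T" "a' \<in> T" "b' \<in> T" for a b a' b'
    using inj_on_eq_iff[OF pr(1), of "(a, b)" "(a', b')"] that by simp
  obtain t0 where t0: "t0 \<in> T" using T by (metis finite.emptyI ex_in_conv)
  obtain t1 where t1: "t1 \<in> T" "t1 \<noteq> t0"
    using T by (metis finite.emptyI finite_insert insertCI subsetI finite_subset)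
  obtain g where g: "inj_on g K" "g ` K \<subseteq> T" using K(2) by (rule card_le_injE)
  have gT: "k \<in> K \<Longrightarrow> g k \<in> T" for k using g(2) by blast
  \<comment> \<open>The tags \<open>t0\<close> and \<open>t1\<close> keep two kinds of information
    apart inside \<open>T\<close>. \<open>P1\<close> decides whether \<open>k\<close> itself is in
    \<open>A\<close>, since the trace on \<open>underS r k\<close> leaves \<open>k\<close>
    out.\<close>
  define P0 where "P0 A = {pr (t0, pr (g k, t)) | k t. k \<in> K \<and> t \<in> C k (A \<inter> underS r k)}" for A
  define P1 where "P1 A = {pr (t1, g k) | k. k \<in> K \<and> k \<in> A}" for A
  have sm: "|A \<inter> Z| \<le>o |T|" if "|A| \<le>o |T|" for A Z :: "'b set"
    using that card_of_mono1[of "A \<inter> Z" A] ordLeq_transitive by blast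
  have CT: "C k (A \<inter> underS r k) \<subseteq> T" if "|A| \<le>o |T|" "k \<in> K" for A k
    using antichain_coloursD(1)[OF IH[of k], of "A \<inter> underS r k"] K(1) that sm by blast
  have sub: "P0 A \<union> P1 A \<subseteq> T" if "A \<subseteq> \<delta>" "|A| \<le>o |T|" for A
    unfolding P0_def P1_def using CT[OF that(2)] gT t0 t1(1) pr(2) by blast
  have dec0: "t \<in> C k (A \<inter> underS r k) \<longleftrightarrow> pr (t0, pr (g k, t)) \<in> P0 A \<union> P1 A"
    if "|A| \<le>o |T|" "k \<in> K" "t \<in> T" for A k t
  proof
    assume "pr (t0, pr (g k, t)) \<in> P0 A \<union> P1 A"
    then consider (0) k' t' where "pr (t0, pr (g k, t)) = pr (t0, pr (g k', t'))" "k' \<in> K" "t' \<in> C k' (A \<inter> underS r k')"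
      | (1) k' where "pr (t0, pr (g k, t)) = pr (t1, g k')" "k' \<in> K"
      unfolding P0_def P1_def by blast
    then show "t \<in> C k (A \<inter> underS r k)"
    proof cases
      case 0
      have t': "t' \<in> T" using CT[OF that(1)] 0 by blast
      have "g k = g k' \<and> t = t'"
        using 0 pr_eq t0 gT that t' pr(2) by simp
      then show ?thesis using 0 g(1) that(2) by (metis inj_on_eq_iff)
    next
      case 1
      then show ?thesis using pr_eq t0 t1 gT that pr(2) by simp
    qed
  next
    assume "t \<in> C k (A \<inter> underS r k)"
    then show "pr (t0, pr (g k, t)) \<in> P0 A \<union> P1 A" unfolding P0_def using that(2) by blast
  qed
  have dec1: "k \<in> A \<longleftrightarrow> pr (t1, g k) \<in> P0 A \<union> P1 A"
    if "|A| \<le>o |T|" "k \<in> K" for A k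
  proof
    assume "pr (t1, g k) \<in> P0 A \<union> P1 A"
    then consider (0) k' t' where "pr (t1, g k) = pr (t0, pr (g k', t'))" "k' \<in> K" "t' \<in> C k' (A \<inter> underS r k')"
      | (1) k' where "pr (t1, g k) = pr (t1, g k')" "k' \<in> K" "k' \<in> A"
      unfolding P0_def P1_def by blast
    then show "k \<in> A"
    proof cases
      case 0
      have t': "t' \<in> T" using CT[OF that(1)] 0 by blast
      then show ?thesis
        using 0 pr_eq t0 t1 gT that t' pr(2) by simp
    next
      case 1
      then have "g k = g k'" using pr_eq t1 gT that by simp
      then show ?thesis using 1 g(1) that(2) by (metis inj_on_eq_iff)
    qed
  next
    assume "k \<in> A"
    then show "pr (t1, g k) \<in> P0 A \<union> P1 A" unfolding P1_def using that(2) by blast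
  qed
  have inj: "A = B" if AB: "A \<subseteq> B" "B \<subseteq> \<delta>" "|B| \<le>o |T|" and eq: "P0 A \<union> P1 A = P0 B \<union> P1 B" for A B
  proof -
    have A: "|A| \<le>o |T|" using AB card_of_mono1 ordLeq_transitive by blast
    have "x \<in> A" if x: "x \<in> B" for x
    proof -
      obtain k where k: "k \<in> K" "(x, k) \<in> r" using K(3) AB(2) x by blast
      have "C k (A \<inter> underS r k) = C k (B \<inter> underS r k)"
        using CT[OF A k(1)] CT[OF AB(3) k(1)] dec0[OF A k(1)] dec0[OF AB(3) k(1)] eq by blast
      then have "A \<inter> underS r k = B \<inter> underS r k"
        using antichain_coloursD(2)[OF IH[of k], of "A \<inter> underS r k" "B \<inter> underS r k"] K(1) k(1) AB sm by blast
      moreover have "k \<in> A \<longleftrightarrow> k \<in> B" using dec1[OF A k(1)] dec1[OF AB(3) k(1)] eq by simp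
      ultimately show ?thesis using x k(2) by (cases "x = k") (auto simp: underS_def)
    qed
    then show "A = B" using AB(1) by blast
  qed
  have "antichain_colours T \<delta> (\<lambda>A. P0 A \<union> P1 A)"
    unfolding antichain_colours_def using sub inj by blast
  then show ?thesis by blast
qed

lemma antichain_colours_noncofinal:
  assumes T: "infinite T" and r: "Well_order r" and F: "Field r = UNIV"
    and nK: "\<And>K. K \<subseteq> \<delta> \<Longrightarrow> |K| \<le>o |T| \<Longrightarrow> \<exists>x\<in>\<delta>. \<forall>k\<in>K. (x, k) \<notin> r"
    and IH: "\<And>a. a \<in> \<delta> \<Longrightarrow> antichain_colours T (underS r a) (C a)"
  shows "\<exists>c. antichain_colours T \<delta> c"
proof -
  have tot: "Total r" and re: "Refl r" and tr: "trans r" and an: "antisym r" and wf: "wf (r - Id)"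
    using r by (simp_all add: well_order_on_def linear_order_on_def partial_order_on_def preorder_on_def)
  obtain pr where pr: "inj_on pr (T \<times> T)" "\<And>a b. a \<in> T \<Longrightarrow> b \<in> T \<Longrightarrow> pr (a, b) \<in> T"
    using infinite_pairing[OF T] by blast
  have pr_eq: "pr (a, b) = pr (a', b') \<longleftrightarrow> a = a' \<and> b = b'"
    if "a \<in> T" "b \<in> T" "a' \<in> T" "b' \<in> T" for a b a' b'
    using inj_on_eq_iff[OF pr(1), of "(a, b)" "(a', b')"] that by simp
  obtain t0 where t0: "t0 \<in> T" using T by (metis finite.emptyI ex_in_conv)
  obtain t1 where t1: "t1 \<in> T" "t1 \<noteq> t0"
    using T by (metis finite.emptyI finite_insert insertCI subsetI finite_subset)
  have "\<exists>e. \<forall>A :: 'b set. |A| \<le>o |T| \<longrightarrow> inj_on (e A) A \<and> e A ` A \<subseteq> T"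
    by (rule choice) (meson card_of_ordLeq)
  then obtain e where e0: "\<forall>A :: 'b set. |A| \<le>o |T| \<longrightarrow> inj_on (e A) A \<and> e A ` A \<subseteq> T" ..
  have e: "|A| \<le>o |T| \<Longrightarrow> inj_on (e A) A" "|A| \<le>o |T| \<Longrightarrow> e A ` A \<subseteq> T" for A :: "'b set"
    using e0[rule_format, of A] by simp_all
  define Q where "Q A a \<longleftrightarrow> a \<in> \<delta> \<and> A \<subseteq> underS r a" for A a
  have Qex: "\<exists>a. Q A a" if A: "A \<subseteq> \<delta>" "|A| \<le>o |T|" for A
  proof -
    obtain x where x: "x \<in> \<delta>" "\<forall>k\<in>A. (x, k) \<notin> r" using nK[OF A] by blast
    have "k \<in> underS r x" if "k \<in> A" for k
    proof -
      have "(x, k) \<notin> r" using x that by blast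
      then have "(k, x) \<in> r" "k \<noteq> x" using tot re F unfolding total_on_def refl_on_def by (metis UNIV_I)+
      then show ?thesis by (simp add: underS_def)
    qed
    then show ?thesis using x unfolding Q_def by blast
  qed
  \<comment> \<open>The choice depends on \<open>A\<close> only through the predicate
    \<open>Q A\<close>, so sets with the same strict bounds in \<open>\<delta>\<close> get the same
    \<open>b\<close>.\<close>
  define b where "b A = (SOME a. Q A a)" for A
  have bQ: "Q A (b A)" if "A \<subseteq> \<delta>" "|A| \<le>o |T|" for A
    unfolding b_def using Qex[OF that] by (rule someI_ex)
  define P0 where "P0 A = (\<lambda>x. pr (t0, x)) ` C (b A) A" for A
  \<comment> \<open>A copy in \<open>T\<close>, along \<open>e A\<close>, of the order on
    \<open>A\<close>; it records the order type.\<close>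
  define P1 where "P1 A = {pr (t1, pr (e A x, e A y)) | x y. x \<in> A \<and> y \<in> A \<and> (x, y) \<in> r}" for A
  have CT: "C (b A) A \<subseteq> T" if "A \<subseteq> \<delta>" "|A| \<le>o |T|" for A
    using antichain_coloursD(1)[OF IH[of "b A"], of A] bQ[OF that] that unfolding Q_def by blast
  have eT: "x \<in> A \<Longrightarrow> e A x \<in> T" if "|A| \<le>o |T|" for A x using e(2)[OF that] by blast
  have sub: "P0 A \<union> P1 A \<subseteq> T" if "A \<subseteq> \<delta>" "|A| \<le>o |T|" for A
    unfolding P0_def P1_def using CT[OF that] eT[OF that(2)] t0 t1(1) pr(2) by blast
  have dec0: "t \<in> C (b A) A \<longleftrightarrow> pr (t0, t) \<in> P0 A \<union> P1 A"
    if "A \<subseteq> \<delta>" "|A| \<le>o |T|" "t \<in> T" for A t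
  proof
    assume "pr (t0, t) \<in> P0 A \<union> P1 A"
    then consider (0) t' where "pr (t0, t) = pr (t0, t')" "t' \<in> C (b A) A"
      | (1) x y where "pr (t0, t) = pr (t1, pr (e A x, e A y))" "x \<in> A" "y \<in> A"
      unfolding P0_def P1_def by blast
    then show "t \<in> C (b A) A"
    proof cases
      case 0
      then show ?thesis using pr_eq t0 that CT[OF that(1,2)] by (metis subsetD)
    next
      case 1
      then show ?thesis using pr_eq t0 t1 eT[OF that(2)] that pr(2) by simp
    qed
  next
    assume "t \<in> C (b A) A"
    then show "pr (t0, t) \<in> P0 A \<union> P1 A" unfolding P0_def by blast
  qed
  have dec1: "(\<exists>x\<in>A. \<exists>y\<in>A. s = e A x \<and> t = e A y \<and> (x, y) \<in> r) \<longleftrightarrow> pr (t1, pr (s, t)) \<in> P0 A \<union> P1 A"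
    if "A \<subseteq> \<delta>" "|A| \<le>o |T|" "s \<in> T" "t \<in> T" for A s t
  proof
    assume "pr (t1, pr (s, t)) \<in> P0 A \<union> P1 A"
    then consider (0) t' where "pr (t1, pr (s, t)) = pr (t0, t')" "t' \<in> C (b A) A"
      | (1) x y where "pr (t1, pr (s, t)) = pr (t1, pr (e A x, e A y))" "x \<in> A" "y \<in> A" "(x, y) \<in> r"
      unfolding P0_def P1_def by blast
    then show "\<exists>x\<in>A. \<exists>y\<in>A. s = e A x \<and> t = e A y \<and> (x, y) \<in> r"
    proof cases
      case 0
      have "t' \<in> T" using 0 CT[OF that(1,2)] by blast
      then show ?thesis using 0 pr_eq t0 t1 that pr(2) by simp
    next
      case 1
      then have "s = e A x" "t = e A y" using pr_eq t1 eT[OF that(2)] that pr(2) by simp_all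
      then show ?thesis using 1 by blast
    qed
  next
    assume "\<exists>x\<in>A. \<exists>y\<in>A. s = e A x \<and> t = e A y \<and> (x, y) \<in> r"
    then show "pr (t1, pr (s, t)) \<in> P0 A \<union> P1 A" unfolding P1_def by blast
  qed
  have inj: "A = B" if AB: "A \<subseteq> B" "B \<subseteq> \<delta>" "|B| \<le>o |T|" and eq: "P0 A \<union> P1 A = P0 B \<union> P1 B" for A B
  proof -
    have A: "|A| \<le>o |T|" "A \<subseteq> \<delta>" using AB card_of_mono1 ordLeq_transitive by blast+
    have iso: "\<exists>x'\<in>A. \<exists>y'\<in>A. e B x = e A x' \<and> e B y = e A y' \<and> (x', y') \<in> r"
      if "x \<in> B" "y \<in> B" "(x, y) \<in> r" for x y
    proof -
      have T2: "e B x \<in> T" "e B y \<in> T" using eT[OF AB(3)] that by blast+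
      have "pr (t1, pr (e B x, e B y)) \<in> P0 B \<union> P1 B"
        using dec1[OF AB(2,3) T2] that by blast
      then show ?thesis using dec1[OF A(2,1) T2] eq by simp
    qed
    \<comment> \<open>Equal copies in \<open>T\<close> make \<open>f\<close> an order embedding of
      \<open>B\<close> into \<open>A\<close>, which lies inside \<open>B\<close>. Since
      \<open>x\<close> is at most \<open>f x\<close>, every strict bound of \<open>A\<close> is one
      of \<open>B\<close>.\<close>
    define f where "f x = inv_into A (e A) (e B x)" for x
    have feq: "f x = x'" if "e B x = e A x'" "x' \<in> A" for x x'
      using that inv_into_f_f[OF e(1)[OF A(1)]] unfolding f_def by simp
    have refl: "(x, x) \<in> r" for x using re F by (simp add: refl_on_def)
    have fA: "f x \<in> A \<and> e A (f x) = e B x" if xB: "x \<in> B" for x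
    proof -
      obtain x' where "x' \<in> A" "e B x = e A x'" using iso[OF xB xB refl] by blast
      then show ?thesis using feq by metis
    qed
    have mon: "(f x, f y) \<in> r" if xy: "x \<in> B" "y \<in> B" "(x, y) \<in> r" for x y
    proof -
      obtain x' y' where "x' \<in> A" "y' \<in> A" "e B x = e A x'" "e B y = e A y'" "(x', y') \<in> r"
        using iso[OF xy] by blast
      then show ?thesis using feq by metis
    qed
    have finj: "inj_on f B"
      using fA e(1)[OF AB(3)] unfolding inj_on_def by metis
    have fB: "f ` B \<subseteq> B" using fA AB(1) by blast
    have infl: "(x, f x) \<in> r" if "x \<in> B" for x
      by (rule order_embedding_inflationary[OF r _ fB mon finj that]) (use F in auto)
    have QAB: "Q A a \<longleftrightarrow> Q B a" for a
    proof
      assume "Q B a" then show "Q A a" using AB(1) unfolding Q_def by blast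
    next
      assume q: "Q A a"
      have "x \<in> underS r a" if "x \<in> B" for x
      proof -
        have "(f x, a) \<in> r" "f x \<noteq> a" using q fA[OF that] unfolding Q_def underS_def by blast+
        then show ?thesis using infl[OF that] tr an unfolding underS_def trans_def antisym_def by blast
      qed
      then show "Q B a" using q unfolding Q_def by blast
    qed
    then have "Q A = Q B" by (intro ext)
    then have bb: "b A = b B" unfolding b_def by simp
    have "C (b A) A = C (b B) B"
      using CT[OF A(2,1)] CT[OF AB(2,3)] dec0[OF A(2,1)] dec0[OF AB(2,3)] eq by blast
    then show "A = B"
      using antichain_coloursD(2)[OF IH[of "b B"] AB(1)] bQ[OF AB(2,3)] AB(3) bb unfolding Q_def by simp
  qed
  have "antichain_colours T \<delta> (\<lambda>A. P0 A \<union> P1 A)"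
    unfolding antichain_colours_def using sub inj by blast
  then show ?thesis by blast
qed

lemma antichain_colours_infinite:
  fixes T :: "'a set"
  assumes T: "infinite T"
  shows "\<exists>c. antichain_colours T (UNIV :: 'b set) c"
proof -
  obtain r :: "'b rel" where r: "Well_order r" "Field r = UNIV"
    using well_ordering[where ?'a = 'b] by blast
  have wf: "wf (r - Id)" using r(1) by (simp add: well_order_on_def)
  \<comment> \<open>Arbitrary \<open>\<delta>\<close> is allowed because the last application is to
    the whole type, which is not of the form \<open>underS r a\<close>.\<close>
  have step: "\<exists>c. antichain_colours T \<delta> c"
    if "\<And>a. a \<in> \<delta> \<Longrightarrow> \<exists>c. antichain_colours T (underS r a) c" for \<delta>
  proof -
    have "\<exists>C. \<forall>a\<in>\<delta>. antichain_colours T (underS r a) (C a)"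
      using that by (intro bchoice ballI)
    then obtain C where C0: "\<forall>a\<in>\<delta>. antichain_colours T (underS r a) (C a)" ..
    have C: "antichain_colours T (underS r a) (C a)" if "a \<in> \<delta>" for a
      using bspec[OF C0 that] .
    show ?thesis
    proof (cases "\<exists>K\<subseteq>\<delta>. |K| \<le>o |T| \<and> (\<forall>x\<in>\<delta>. \<exists>k\<in>K. (x, k) \<in> r)")
      case True
      then show ?thesis using antichain_colours_cofinal[OF T r(1) _ _ _ C] by blast
    next
      case False
      show ?thesis by (rule antichain_colours_noncofinal[OF T r _ C]) (use False in blast)+
    qed
  qed
  have "\<exists>c. antichain_colours T (underS r a) c" for a
  proof (induction a rule: wf_induct_rule[OF wf])
    case (1 a)
    show ?case by (rule step) (rule 1, simp add: underS_def)
  qed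
  then show ?thesis by (rule step)
qed

text \<open>For infinite \<open>T\<close> the colour is a subset of \<open>T\<close> and the number
  is constantly 0. For finite \<open>T\<close> the number is the cardinality, which already
  separates nested finite sets.\<close>

lemma antichain_colouring:
  fixes T :: "'a set"
  obtains c :: "'b set \<Rightarrow> 'a set \<times> nat" where
    "\<And>A. |A| \<le>o |T| \<Longrightarrow> c A \<in> Pow T \<times> UNIV"
    "\<And>A B. A \<subseteq> B \<Longrightarrow> |B| \<le>o |T| \<Longrightarrow> c A = c B \<Longrightarrow> A = B"
proof (cases "finite T")
  case True
  have fin: "finite B" if "|B| \<le>o |T|" for B :: "'b set"
    using card_of_ordLeq_finite[OF that True] .
  show ?thesis
    by (rule that[of "\<lambda>A. ({}, card A)"]) (auto dest: fin card_subset_eq)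
next
  case False
  obtain c :: "'b set \<Rightarrow> 'a set" where c: "antichain_colours T UNIV c"
    using antichain_colours_infinite[OF False] by blast
  show ?thesis
    by (rule that[of "\<lambda>A. (c A, 0)"]) (use antichain_coloursD[OF c] in auto)
qed

section \<open>Codes for cardinalities; maximal disjoint families\<close>

lemma card_less_iso_underS:
  assumes "|D| <o |P|"
  obtains a where "a \<in> P" "|D| =o |underS |P| a|"
proof -
  have wo: "wo_rel |P|" using card_of_Well_order by (simp add: wo_rel_def)
  obtain a where a: "a \<in> P" "|D| =o Restr |P| (underS |P| a)"
    using ordLess_iff_ordIso_Restr[of "|P|" "|D|"] assms card_of_Well_order[of P] card_of_Well_order[of D]
    by (auto simp: Field_card_of)
  have "Field (Restr |P| (underS |P| a)) = underS |P| a"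
    using wo_rel.underS_ofilter[OF wo] Field_Restr_ofilter[OF card_of_Well_order] by blast
  then have "|D| =o |underS |P| a|" using card_of_cong[OF a(2)] by (simp add: Field_card_of)
  then show thesis using that a(1) by blast
qed

lemma card_underS_card_of: "a \<in> P \<Longrightarrow> |underS |P| a| <o |P|"
  using card_of_underS[OF card_of_Card_order, of a P] by (simp add: Field_card_of)

text \<open>A cardinal below \<open>|P|\<close> is that of an initial segment
  \<open>underS |P| a\<close> and is coded by \<open>a\<close> with tag \<open>t0\<close>; the tag
  \<open>t1\<close> is reserved for \<open>|P|\<close> itself. So \<open>P\<close> has room for all
  cardinalities up to its own.\<close>

lemma cardinality_code:
  assumes P: "infinite P"
  obtains c :: "'b set \<Rightarrow> 'a" where "\<And>D. |D| \<le>o |P| \<Longrightarrow> c D \<in> P"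
    "\<And>D D'. |D| \<le>o |P| \<Longrightarrow> |D'| \<le>o |P| \<Longrightarrow> c D = c D' \<Longrightarrow> |D| =o |D'|"
proof -
  obtain pr where pr: "inj_on pr (P \<times> P)" "\<And>a b. a \<in> P \<Longrightarrow> b \<in> P \<Longrightarrow> pr (a, b) \<in> P"
    using infinite_pairing[OF P] by blast
  have pr_eq: "pr (a, b) = pr (a', b') \<longleftrightarrow> a = a' \<and> b = b'"
    if "a \<in> P" "b \<in> P" "a' \<in> P" "b' \<in> P" for a b a' b'
    using inj_on_eq_iff[OF pr(1), of "(a, b)" "(a', b')"] that by simp
  obtain t0 where t0: "t0 \<in> P" using P by (metis finite.emptyI ex_in_conv)
  obtain t1 where t1: "t1 \<in> P" "t1 \<noteq> t0"
    using P by (metis finite.emptyI finite_insert insertCI subsetI finite_subset)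
  define u where "u D = (SOME a. a \<in> P \<and> |D| =o |underS |P| a| )" for D :: "'b set"
  have u: "u D \<in> P \<and> |D| =o |underS |P| (u D)|" if "|D| <o |P|" for D
    unfolding u_def by (rule someI_ex) (use card_less_iso_underS[OF that] in metis)
  define c where "c D = (if |D| <o |P| then pr (t0, u D) else pr (t1, t0))" for D
  show thesis
  proof (rule that)
    fix D :: "'b set" assume "|D| \<le>o |P|"
    then show "c D \<in> P" unfolding c_def using u[of D] pr(2) t0 t1 by simp
  next
    fix D D' :: "'b set" assume D: "|D| \<le>o |P|" "|D'| \<le>o |P|" "c D = c D'"
    show "|D| =o |D'|"
    proof (cases "|D| <o |P|")
      case True
      have D': "|D'| <o |P|"
        using D(3) True u[OF True] pr_eq t0 t1 unfolding c_def by (auto split: if_splits)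
      then have "u D = u D'" using D(3) True u[OF True] u[OF D'] pr_eq t0 unfolding c_def by simp
      then show ?thesis using u[OF True] u[OF D'] ordIso_symmetric ordIso_transitive by metis
    next
      case False
      have D': "\<not> |D'| <o |P|"
        using D(3) False u[of D'] pr_eq t0 t1 unfolding c_def by (auto split: if_splits)
      have "|D| =o |P|" "|D'| =o |P|"
        using False D' D(1,2) card_less_or_le ordIso_of_antisym by blast+
      then show ?thesis using ordIso_symmetric ordIso_transitive by blast
    qed
  qed
qed

text \<open>Zorn's lemma: a nonempty \<open>p\<close> disjoint from every member of a maximal
  disjoint \<open>D\<close> could be added to it.\<close>

lemma maximal_disjoint_subfamily:
  shows "\<exists>D. D \<subseteq> P \<and> pairwise disjnt D \<and> (\<forall>p\<in>P. p \<noteq> {} \<longrightarrow> (\<exists>d\<in>D. \<not> disjnt p d))"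
proof -
  have "\<exists>M\<in>{D. D \<subseteq> P \<and> pairwise disjnt D}. \<forall>Z\<in>{D. D \<subseteq> P \<and> pairwise disjnt D}. M \<subseteq> Z \<longrightarrow> Z = M"
  proof (rule subset_Zorn')
    fix \<C> assume ch: "subset.chain {D. D \<subseteq> P \<and> pairwise disjnt D} \<C>"
    have "pairwise disjnt (\<Union>\<C>)"
    proof (rule pairwiseI)
      fix a b assume "a \<in> \<Union>\<C>" "b \<in> \<Union>\<C>" "a \<noteq> b"
      then obtain A B where AB: "A \<in> \<C>" "B \<in> \<C>" "a \<in> A" "b \<in> B" by blast
      then have "A \<subseteq> B \<or> B \<subseteq> A" using ch unfolding subset_chain_def by blast
      then obtain E where E: "E \<in> \<C>" "a \<in> E" "b \<in> E" using AB by blast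
      then have "pairwise disjnt E" using ch unfolding subset_chain_def by blast
      then show "disjnt a b" using E(2,3) \<open>a \<noteq> b\<close> by (rule pairwiseD)
    qed
    then show "\<Union>\<C> \<in> {D. D \<subseteq> P \<and> pairwise disjnt D}" using ch unfolding subset_chain_def by blast
  qed
  then obtain D where D0: "D \<in> {D. D \<subseteq> P \<and> pairwise disjnt D}"
    "\<forall>Z\<in>{D. D \<subseteq> P \<and> pairwise disjnt D}. D \<subseteq> Z \<longrightarrow> Z = D" ..
  then have D: "D \<subseteq> P" "pairwise disjnt D" by simp_all
  have D3: "Z = D" if "Z \<subseteq> P" "pairwise disjnt Z" "D \<subseteq> Z" for Z
    using D0(2) that by simp
  have "\<exists>d\<in>D. \<not> disjnt p d" if p: "p \<in> P" "p \<noteq> {}" for p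
  proof (rule ccontr)
    assume n: "\<not> (\<exists>d\<in>D. \<not> disjnt p d)"
    then have "pairwise disjnt (insert p D)"
      using D(2) by (auto simp: pairwise_insert disjnt_sym)
    then have "p \<in> D" using D3[of "insert p D"] D(1) p(1) by blast
    then show False using n p(2) by auto
  qed
  then show ?thesis using D(1,2) by blast
qed

section \<open>Noetherian families and rich points\<close>

lemma noetherian_familyD:
  assumes "noetherian_family B" "infinite I"
    and "\<And>i j. i \<in> I \<Longrightarrow> j \<in> I \<Longrightarrow> i < j \<Longrightarrow> f i \<subset> f j"
  shows "\<exists>i\<in>(I :: nat set). f i \<notin> B"
proof (rule ccontr)
  assume "\<not> ?thesis"
  then have 1: "\<forall>n. f (enumerate I n) \<in> B" using enumerate_in_set[OF assms(2)] by blast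
  have 2: "\<forall>n. f (enumerate I n) \<subset> f (enumerate I (Suc n))"
    using enumerate_in_set[OF assms(2)] enumerate_step[OF assms(2)] assms(3) by blast
  show False
    by (rule notE[OF assms(1)[unfolded noetherian_family_def]])
      (rule exI[of _ "\<lambda>n. f (enumerate I n)"], rule conjI[OF 1 2])
qed

lemma noetherian_family_subset: "noetherian_family B \<Longrightarrow> A \<subseteq> B \<Longrightarrow> noetherian_family A"
  unfolding noetherian_family_def by blast

lemma strict_chain_less:
  fixes f :: "nat \<Rightarrow> 'a set"
  assumes "\<And>n. f n \<subset> f (Suc n)" "i < j"
  shows "f i \<subset> f j"
  using lift_Suc_mono_less[of f i j] assms by blast

lemma noetherian_family_Un:
  assumes "noetherian_family A" "noetherian_family B"
  shows "noetherian_family (A \<union> B)"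
  unfolding noetherian_family_def
proof
  assume "\<exists>f :: nat \<Rightarrow> 'a set. (\<forall>n. f n \<in> A \<union> B) \<and> (\<forall>n. f n \<subset> f (Suc n))"
  then obtain f :: "nat \<Rightarrow> 'a set" where f: "\<And>n. f n \<in> A \<union> B" "\<And>n. f n \<subset> f (Suc n)" by blast
  have "{n. f n \<in> A} \<union> {n. f n \<in> B} = UNIV" using f(1) by blast
  then have "infinite {n. f n \<in> A} \<or> infinite {n. f n \<in> B}"
    by (metis finite_Un infinite_UNIV_nat)
  then show False
    using noetherian_familyD[OF assms(1), of "{n. f n \<in> A}" f]
      noetherian_familyD[OF assms(2), of "{n. f n \<in> B}" f] strict_chain_less[of f, OF f(2)]
    by blast
qed

lemma well_order_least:
  assumes r: "Well_order r" "Field r = UNIV" and "Q \<noteq> {}"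
  obtains q where "q \<in> Q" "\<And>q'. q' \<in> Q \<Longrightarrow> (q, q') \<in> r"
proof -
  have wf: "wf (r - Id)" and tot: "total r" and re: "Refl r"
    using r by (simp_all add: well_order_on_def linear_order_on_def partial_order_on_def preorder_on_def)
  obtain a where a: "a \<in> Q" using \<open>Q \<noteq> {}\<close> by auto
  obtain q where q: "q \<in> Q" "\<And>q'. (q', q) \<in> r - Id \<Longrightarrow> q' \<notin> Q"
    by (rule wfE_min[OF wf a]) auto
  have "(q, q') \<in> r" if q': "q' \<in> Q" for q'
  proof (cases "q = q'")
    case True
    then show ?thesis using re r(2) by (simp add: refl_on_def)
  next
    case False
    then have "(q, q') \<in> r \<or> (q', q) \<in> r" using tot r(2) unfolding total_on_def by blast
    then show ?thesis using q(2)[of q'] q' False by auto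
  qed
  then show thesis using that q(1) by blast
qed

text \<open>In a well-order of all sets, \<open>B\<close> keeps those members of \<open>N\<close>
  that are preceded by no member of \<open>N\<close> included in them. The first subset of
  \<open>V\<close> in \<open>N\<close> is kept, and a strictly increasing sequence of kept sets
  would descend in the well-order.\<close>

lemma coinitial_noetherian:
  fixes N :: "'a set set"
  obtains B where "B \<subseteq> N" "noetherian_family B" "\<And>V. V \<in> N \<Longrightarrow> \<exists>W\<in>B. W \<subseteq> V"
proof -
  obtain r :: "'a set rel" where r: "Well_order r" "Field r = UNIV"
    using well_ordering[where ?'a = "'a set"] by blast
  have wf: "wf (r - Id)" and tot: "total r"
    using r by (simp_all add: well_order_on_def linear_order_on_def)
  define B where "B = {V \<in> N. \<forall>W\<in>N. W \<subseteq> V \<longrightarrow> (W, V) \<notin> r - Id}"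
  have an: "antisym r"
    using r by (simp add: well_order_on_def linear_order_on_def partial_order_on_def)
  have ex: "\<exists>W\<in>B. W \<subseteq> V" if V: "V \<in> N" for V
  proof -
    obtain W where W: "W \<in> {W \<in> N. W \<subseteq> V}" "\<And>Z. Z \<in> {W \<in> N. W \<subseteq> V} \<Longrightarrow> (W, Z) \<in> r"
      by (rule well_order_least[OF r, of "{W \<in> N. W \<subseteq> V}"]) (use V in auto)
    have "(Z, W) \<notin> r - Id" if "Z \<in> N" "Z \<subseteq> W" for Z
      using W that an unfolding antisym_def by blast
    then have "W \<in> B" using W(1) unfolding B_def by blast
    then show ?thesis using W by blast
  qed
  have "noetherian_family B"
    unfolding noetherian_family_def
  proof
    assume "\<exists>f :: nat \<Rightarrow> 'a set. (\<forall>n. f n \<in> B) \<and> (\<forall>n. f n \<subset> f (Suc n))"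
    then obtain f :: "nat \<Rightarrow> 'a set" where f: "\<And>n. f n \<in> B" "\<And>n. f n \<subset> f (Suc n)" by blast
    have "(f (Suc n), f n) \<in> r - Id" for n
    proof -
      have ne: "f n \<noteq> f (Suc n)" using f(2)[of n] by blast
      have "(f n, f (Suc n)) \<notin> r - Id" using f(1)[of n] f(1)[of "Suc n"] f(2)[of n] unfolding B_def by blast
      then show ?thesis using tot ne unfolding total_on_def by blast
    qed
    then show False using wf unfolding wf_iff_no_infinite_down_chain by blast
  qed
  then show thesis using that[of B] ex unfolding B_def by blast
qed

section \<open>Rich points and good sets in a T3 space\<close>

locale t3 =
  fixes X :: "'a topology"
  assumes t1: "t1_space X" and reg: "regular_space X"
begin

abbreviation cl :: "'a set \<Rightarrow> 'a set" where "cl S \<equiv> X closure_of S"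

lemma shrink_nbhd:
  assumes "openin X U" "x \<in> U"
  obtains W where "openin X W" "x \<in> W" "cl W \<subseteq> U"
proof -
  have "neighbourhood_base_of (closedin X) X" using reg by (simp add: neighbourhood_base_of_closedin)
  then obtain W C where W: "openin X W" "closedin X C" "x \<in> W" "W \<subseteq> C" "C \<subseteq> U"
    using assms unfolding neighbourhood_base_of by metis
  have "cl W \<subseteq> U" using closure_of_minimal[OF W(4,2)] W(5) by blast
  then show thesis by (rule that[OF W(1,3)])
qed

lemma separate_points:
  assumes "openin X U" "y \<in> U" "x \<in> topspace X" "x \<noteq> y"
  obtains W where "openin X W" "y \<in> W" "cl W \<subseteq> U" "x \<notin> cl W"
proof -
  have "closedin X {x}" using t1 assms(3) by (simp add: t1_space_closedin_singleton)
  then have "openin X (U - {x})" using assms(1) by blast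
  then obtain W where "openin X W" "y \<in> W" "cl W \<subseteq> U - {x}"
    using shrink_nbhd[of "U - {x}" y] assms by blast
  then show thesis using that by blast
qed

text \<open>The sets will be removed from neighbourhoods as closures \<open>cl (A c)\<close>, so
  inclusion in a closure is what must be excluded. The conclusion \<open>c = c'\<close> also makes
  \<open>A\<close> injective on \<open>C\<close>.\<close>

definition open_antichain :: "'a set \<Rightarrow> 'c set \<Rightarrow> ('c \<Rightarrow> 'a set) \<Rightarrow> bool" where
  "open_antichain H C A \<longleftrightarrow>
    (\<forall>c\<in>C. openin X (A c) \<and> A c \<subseteq> H \<and> (\<forall>c'\<in>C. A c \<subseteq> cl (A c') \<longrightarrow> c = c'))"

text \<open>As \<open>x\<close> is outside \<open>cl H\<close>, the set \<open>U - cl H\<close> is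
  again a neighbourhood of \<open>x\<close>, and the choice of \<open>H\<close> can be repeated
  there.\<close>

definition rich :: "'a \<Rightarrow> 'c set \<Rightarrow> bool" where
  "rich x C \<longleftrightarrow> (\<forall>U. openin X U \<and> x \<in> U \<longrightarrow>
    (\<exists>H A. openin X H \<and> H \<subseteq> U \<and> x \<notin> cl H \<and> open_antichain H C A))"

definition system :: "'a set \<Rightarrow> ('a \<times> 'a set) set \<Rightarrow> bool" where
  "system Y S \<longleftrightarrow> (\<forall>(x, V)\<in>S. x \<in> Y \<and> x \<in> V \<and> openin X V) \<and>
    (\<forall>x\<in>Y. \<forall>U. openin X U \<and> x \<in> U \<longrightarrow> (\<exists>V. (x, V) \<in> S \<and> V \<subseteq> U))"

definition good :: "'a set \<Rightarrow> bool" where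
  "good Y \<longleftrightarrow> (\<exists>S. system Y S \<and> noetherian_family (snd ` S))"

lemma systemD:
  assumes "system Y S"
  shows "(x, V) \<in> S \<Longrightarrow> x \<in> Y" "(x, V) \<in> S \<Longrightarrow> x \<in> V" "(x, V) \<in> S \<Longrightarrow> openin X V"
    and "x \<in> Y \<Longrightarrow> openin X U \<Longrightarrow> x \<in> U \<Longrightarrow> \<exists>V. (x, V) \<in> S \<and> V \<subseteq> U"
  using assms unfolding system_def by blast+

lemma systemI:
  assumes "\<And>x V. (x, V) \<in> S \<Longrightarrow> x \<in> Y \<and> x \<in> V \<and> openin X V"
    and "\<And>x U. x \<in> Y \<Longrightarrow> openin X U \<Longrightarrow> x \<in> U \<Longrightarrow> \<exists>V. (x, V) \<in> S \<and> V \<subseteq> U"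
  shows "system Y S"
  using assms unfolding system_def by blast

lemma good_subset:
  assumes "good Y" "Z \<subseteq> Y"
  shows "good Z"
proof -
  obtain S where S: "system Y S" "noetherian_family (snd ` S)" using assms(1) unfolding good_def by blast
  have "system Z (S \<inter> Z \<times> UNIV)"
    using systemD[OF S(1)] assms(2) by (intro systemI) blast+
  moreover have "noetherian_family (snd ` (S \<inter> Z \<times> UNIV))"
    by (rule noetherian_family_subset[OF S(2)]) blast
  ultimately show ?thesis unfolding good_def by blast
qed

lemma good_Un:
  assumes "good Y" "good Z"
  shows "good (Y \<union> Z)"
proof -
  obtain S where S: "system Y S" "noetherian_family (snd ` S)" using assms(1) unfolding good_def by blast
  obtain R where R: "system Z R" "noetherian_family (snd ` R)" using assms(2) unfolding good_def by blast
  have "system (Y \<union> Z) (S \<union> R)"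
  proof (rule systemI)
    fix x V assume "(x, V) \<in> S \<union> R"
    then show "x \<in> Y \<union> Z \<and> x \<in> V \<and> openin X V" using systemD(1-3)[OF S(1)] systemD(1-3)[OF R(1)] by blast
  next
    fix x U assume "x \<in> Y \<union> Z" "openin X U" "x \<in> U"
    then show "\<exists>V. (x, V) \<in> S \<union> R \<and> V \<subseteq> U" using systemD(4)[OF S(1)] systemD(4)[OF R(1)] by blast
  qed
  moreover have "noetherian_family (snd ` (S \<union> R))"
    using noetherian_family_Un[OF S(2) R(2)] by (simp add: image_Un)
  ultimately show ?thesis unfolding good_def by blast
qed

text \<open>Each \<open>x\<close> gets a Noetherian local base inside \<open>U x\<close>. Its
  members meet \<open>Y\<close> in \<open>x\<close> only, so an increasing sequence of chosen sets
  stays in the local base of one point.\<close>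

lemma good_discrete:
  assumes "\<And>x. x \<in> Y \<Longrightarrow> \<exists>U. openin X U \<and> U \<inter> Y = {x}"
  shows "good Y"
proof -
  obtain U where U0: "\<forall>x\<in>Y. openin X (U x) \<and> U x \<inter> Y = {x}"
    using bchoice[of Y "\<lambda>x U. openin X U \<and> U \<inter> Y = {x}"] assms by auto
  have U: "openin X (U x)" "U x \<inter> Y = {x}" if "x \<in> Y" for x using U0 that by blast+
  define N where "N x = {V. openin X V \<and> x \<in> V \<and> V \<subseteq> U x}" for x
  have "\<exists>B. B \<subseteq> N x \<and> noetherian_family B \<and> (\<forall>V\<in>N x. \<exists>W\<in>B. W \<subseteq> V)" for x
    using coinitial_noetherian[of "N x"] by metis
  then obtain B where "\<forall>x. B x \<subseteq> N x \<and> noetherian_family (B x) \<and> (\<forall>V\<in>N x. \<exists>W\<in>B x. W \<subseteq> V)"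
    using choice[of "\<lambda>x B. B \<subseteq> N x \<and> noetherian_family B \<and> (\<forall>V\<in>N x. \<exists>W\<in>B. W \<subseteq> V)"] by auto
  then have B: "B x \<subseteq> N x" "noetherian_family (B x)" "\<And>V. V \<in> N x \<Longrightarrow> \<exists>W\<in>B x. W \<subseteq> V" for x
    by blast+
  define S where "S = {(x, V). x \<in> Y \<and> V \<in> B x}"
  have "system Y S"
  proof (rule systemI)
    fix x V assume "(x, V) \<in> S"
    then show "x \<in> Y \<and> x \<in> V \<and> openin X V" using B(1)[of x] unfolding S_def N_def by blast
  next
    fix x W assume x: "x \<in> Y" and W: "openin X W" "x \<in> W"
    have "W \<inter> U x \<in> N x" using U[OF x] W unfolding N_def by blast
    then obtain V where "V \<in> B x" "V \<subseteq> W \<inter> U x" using B(3) by blast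
    then show "\<exists>V. (x, V) \<in> S \<and> V \<subseteq> W" using x unfolding S_def by blast
  qed
  moreover have "noetherian_family (snd ` S)"
    unfolding noetherian_family_def
  proof
    assume "\<exists>f :: nat \<Rightarrow> 'a set. (\<forall>n. f n \<in> snd ` S) \<and> (\<forall>n. f n \<subset> f (Suc n))"
    then obtain f :: "nat \<Rightarrow> 'a set" where f: "\<And>n. f n \<in> snd ` S" "\<And>n. f n \<subset> f (Suc n)" by blast
    have YV: "V \<inter> Y = {x}" if "(x, V) \<in> S" for x V
      using that B(1)[of x] U[of x] unfolding S_def N_def by blast
    obtain x where x: "(x, f 0) \<in> S" using f(1)[of 0] by force
    have "f n \<in> B x" for n
    proof -
      obtain y where y: "(y, f n) \<in> S" using f(1)[of n] by force
      have "f 0 \<subseteq> f n" using lift_Suc_mono_le[of f 0 n] f(2) by blast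
      then have "x = y" using YV[OF x] YV[OF y] by blast
      then show ?thesis using y unfolding S_def by blast
    qed
    then show False using B(2)[of x] f(2) unfolding noetherian_family_def by blast
  qed
  ultimately show ?thesis unfolding good_def by blast
qed

lemma open_antichainD:
  assumes "open_antichain H C A" "c \<in> C"
  shows "openin X (A c)" "A c \<subseteq> H" "c' \<in> C \<Longrightarrow> A c \<subseteq> cl (A c') \<Longrightarrow> c = c'"
  using assms unfolding open_antichain_def by blast+

lemma open_antichainI:
  assumes "\<And>c. c \<in> C \<Longrightarrow> openin X (A c)" "\<And>c. c \<in> C \<Longrightarrow> A c \<subseteq> H"
    and "\<And>c c'. c \<in> C \<Longrightarrow> c' \<in> C \<Longrightarrow> A c \<subseteq> cl (A c') \<Longrightarrow> c = c'"
  shows "open_antichain H C A"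
  using assms unfolding open_antichain_def by blast

lemma open_antichain_reindex:
  assumes "open_antichain H C A" "inj_on g D" "g ` D \<subseteq> C"
  shows "open_antichain H D (A \<circ> g)"
proof (rule open_antichainI)
  fix c assume "c \<in> D"
  then have "g c \<in> C" using assms(3) by blast
  then show "openin X ((A \<circ> g) c)" "(A \<circ> g) c \<subseteq> H" using open_antichainD(1,2)[OF assms(1)] by simp_all
next
  fix c c' assume c: "c \<in> D" "c' \<in> D" "(A \<circ> g) c \<subseteq> cl ((A \<circ> g) c')"
  then have "g c = g c'" using open_antichainD(3)[OF assms(1), of "g c" "g c'"] assms(3) by auto
  then show "c = c'" using assms(2) c by (simp add: inj_on_def)
qed

lemma open_antichain_ordLeq:
  assumes "open_antichain H C A" "|D| \<le>o |C|"
  obtains A' where "open_antichain H D A'"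
proof -
  obtain g where "inj_on g D" "g ` D \<subseteq> C" using assms(2) by (rule card_le_injE)
  then show thesis using open_antichain_reindex[OF assms(1)] that by blast
qed

lemma rich_ordLeq:
  assumes "rich x C" "|D| \<le>o |C|"
  shows "rich x D"
  unfolding rich_def
proof (intro allI impI)
  fix U assume "openin X U \<and> x \<in> U"
  then obtain H A where H: "openin X H" "H \<subseteq> U" "x \<notin> cl H" "open_antichain H C A"
    using assms(1) unfolding rich_def by blast
  obtain A' where "open_antichain H D A'" using open_antichain_ordLeq[OF H(4) assms(2)] .
  then show "\<exists>H A. openin X H \<and> H \<subseteq> U \<and> x \<notin> cl H \<and> open_antichain H D A" using H by blast
qed

text \<open>An open subset of \<open>H1\<close> misses the closure of every subset of
  \<open>H2\<close>, and conversely, so an inclusion between the unions splits into its two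
  coordinates.\<close>

lemma open_antichain_Times:
  assumes H: "openin X H1" "openin X H2" "H1 \<inter> H2 = {}"
    and A: "open_antichain H1 C A" and B: "open_antichain H2 D B"
  shows "open_antichain (H1 \<union> H2) (C \<times> D) (\<lambda>(c, d). A c \<union> B d)"
proof (rule open_antichainI)
  fix p assume "p \<in> C \<times> D"
  then obtain c d where p: "p = (c, d)" "c \<in> C" "d \<in> D" by blast
  show "openin X (case p of (c, d) \<Rightarrow> A c \<union> B d)"
    using open_antichainD(1)[OF A p(2)] open_antichainD(1)[OF B p(3)] p(1) by auto
  show "(case p of (c, d) \<Rightarrow> A c \<union> B d) \<subseteq> H1 \<union> H2"
    using open_antichainD(2)[OF A p(2)] open_antichainD(2)[OF B p(3)] p(1) by auto
next
  fix p p' assume "p \<in> C \<times> D" "p' \<in> C \<times> D"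
    and sub: "(case p of (c, d) \<Rightarrow> A c \<union> B d) \<subseteq> cl (case p' of (c, d) \<Rightarrow> A c \<union> B d)"
  then obtain c d c' d' where p: "p = (c, d)" "c \<in> C" "d \<in> D" and p': "p' = (c', d')" "c' \<in> C" "d' \<in> D"
    by blast
  have s: "A c \<union> B d \<subseteq> cl (A c') \<union> cl (B d')" using sub p p' by simp
  have A12: "A c \<subseteq> H1" "A c' \<subseteq> H1" "openin X (A c)" "B d \<subseteq> H2" "B d' \<subseteq> H2" "openin X (B d)"
    using open_antichainD(1,2)[OF A] open_antichainD(1,2)[OF B] p p' by blast+
  have "A c \<inter> cl (B d') = {}" "B d \<inter> cl (A c') = {}"
    using openin_Int_closure_of_eq_empty[OF A12(3), of "B d'"]
      openin_Int_closure_of_eq_empty[OF A12(6), of "A c'"] A12 H(3) by auto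
  then have "A c \<subseteq> cl (A c')" "B d \<subseteq> cl (B d')" using s by blast+
  then show "p = p'" using open_antichainD(3)[OF A] open_antichainD(3)[OF B] p p' by blast
qed

lemma rich_Times:
  assumes "rich x C" "rich x D"
  shows "rich x (C \<times> D)"
  unfolding rich_def
proof (intro allI impI)
  fix U assume U: "openin X U \<and> x \<in> U"
  then obtain H1 A where H1: "openin X H1" "H1 \<subseteq> U" "x \<notin> cl H1" "open_antichain H1 C A"
    using assms(1) unfolding rich_def by blast
  have "openin X (U - cl H1) \<and> x \<in> U - cl H1" using U H1(3) by (simp add: openin_diff)
  then obtain H2 B where H2: "openin X H2" "H2 \<subseteq> U - cl H1" "x \<notin> cl H2" "open_antichain H2 D B"
    using assms(2) unfolding rich_def by blast
  have "H1 \<subseteq> cl H1" using H1(1) by (simp add: closure_of_subset openin_subset)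
  then have "open_antichain (H1 \<union> H2) (C \<times> D) (\<lambda>(c, d). A c \<union> B d)"
    using H2(2) by (intro open_antichain_Times H1 H2) blast
  moreover have "openin X (H1 \<union> H2)" "H1 \<union> H2 \<subseteq> U" "x \<notin> cl (H1 \<union> H2)" using H1 H2 by auto
  ultimately show "\<exists>H A. openin X H \<and> H \<subseteq> U \<and> x \<notin> cl H \<and> open_antichain H (C \<times> D) A" by blast
qed

section \<open>Disjoint sequences, punctured neighbourhoods, unions of good sets\<close>

lemma disjoint_sequence:
  assumes Q: "\<And>W. openin X W \<Longrightarrow> x \<in> W \<Longrightarrow> \<exists>H. openin X H \<and> cl H \<subseteq> W \<and> x \<notin> cl H \<and> Q H"
    and U: "openin X U" "x \<in> U"
  shows "\<exists>h :: nat \<Rightarrow> 'a set. (\<forall>n. openin X (h n) \<and> Q (h n) \<and> cl (h n) \<subseteq> U) \<and>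
    (\<forall>m n. m \<noteq> n \<longrightarrow> cl (h m) \<inter> cl (h n) = {})"
proof -
  have "\<exists>H. openin X W \<and> x \<in> W \<longrightarrow> openin X H \<and> cl H \<subseteq> W \<and> x \<notin> cl H \<and> Q H" for W
    using Q by blast
  then have "\<exists>F. \<forall>W. openin X W \<and> x \<in> W \<longrightarrow> openin X (F W) \<and> cl (F W) \<subseteq> W \<and> x \<notin> cl (F W) \<and> Q (F W)"
    by (intro choice allI)
  then obtain F where F0: "\<forall>W. openin X W \<and> x \<in> W \<longrightarrow>
      openin X (F W) \<and> cl (F W) \<subseteq> W \<and> x \<notin> cl (F W) \<and> Q (F W)" ..
  have F: "openin X (F W)" "cl (F W) \<subseteq> W" "x \<notin> cl (F W)" "Q (F W)"
    if "openin X W" "x \<in> W" for W using F0 that by blast+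
  \<comment> \<open>\<open>u n\<close> is what remains of \<open>U\<close> after removing the
    closures of the first \<open>n\<close> choices; it is still a neighbourhood of
    \<open>x\<close>.\<close>
  define u where "u = rec_nat U (\<lambda>_ W. W - cl (F W))"
  have u0: "u 0 = U" and uS: "u (Suc n) = u n - cl (F (u n))" for n unfolding u_def by simp_all
  have u: "openin X (u n) \<and> x \<in> u n" for n
  proof (induction n)
    case (Suc n)
    then show ?case using F(3)[of "u n"] uS by auto
  qed (simp add: u0 U)
  have mono: "u n \<subseteq> u m" if "m \<le> n" for m n
    using lift_Suc_antimono_le[of u m n] uS that by blast
  have disj: "cl (F (u m)) \<inter> cl (F (u n)) = {}" if "m < n" for m n
    using mono[of "Suc m" n] F(2)[of "u n"] u[of n] uS[of m] that by auto
  have "cl (F (u n)) \<subseteq> U" for n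
    using F(2)[of "u n"] u[of n] mono[of 0 n] u0 by auto
  then have "\<forall>n. openin X (F (u n)) \<and> Q (F (u n)) \<and> cl (F (u n)) \<subseteq> U" using F(1,4) u by blast
  moreover have "cl (F (u m)) \<inter> cl (F (u n)) = {}" if "m \<noteq> n" for m n
    using that disj[of m n] disj[of n m] by (metis linorder_neqE_nat inf_commute)
  ultimately show ?thesis by (intro exI[of _ "\<lambda>n. F (u n)"] conjI allI impI) simp_all
qed

text \<open>No point occurs here, so sequences that serve different points can be compared in a
  single well-order.\<close>

definition rich_sequence :: "'c set \<Rightarrow> (nat \<Rightarrow> 'a set) \<Rightarrow> bool" where
  "rich_sequence C h \<longleftrightarrow> (\<forall>n. openin X (h n) \<and> (\<exists>A. open_antichain (h n) C A)) \<and>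
    (\<forall>m n. m \<noteq> n \<longrightarrow> cl (h m) \<inter> cl (h n) = {})"

lemma rich_sequence_exists:
  assumes "rich x C" "openin X U" "x \<in> U"
  obtains h where "rich_sequence C h" "\<And>n. cl (h n) \<subseteq> U"
proof -
  have "\<exists>H. openin X H \<and> cl H \<subseteq> W \<and> x \<notin> cl H \<and> (\<exists>A. open_antichain H C A)"
    if W1: "openin X W" and W2: "x \<in> W" for W
  proof -
    obtain W' where W': "openin X W'" "x \<in> W'" "cl W' \<subseteq> W" using shrink_nbhd W1 W2 by blast
    then obtain H A where "openin X H" "H \<subseteq> W'" "x \<notin> cl H" "open_antichain H C A"
      using assms(1) unfolding rich_def by blast
    then show ?thesis using W'(3) closure_of_mono[of H W' X] by blast
  qed
  then have "\<exists>h :: nat \<Rightarrow> 'a set.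
      (\<forall>n. openin X (h n) \<and> (\<exists>A. open_antichain (h n) C A) \<and> cl (h n) \<subseteq> U) \<and>
      (\<forall>m n. m \<noteq> n \<longrightarrow> cl (h m) \<inter> cl (h n) = {})"
    by (rule disjoint_sequence[OF _ assms(2,3)])
  then obtain h :: "nat \<Rightarrow> 'a set" where
    "\<forall>n. openin X (h n) \<and> (\<exists>A. open_antichain (h n) C A) \<and> cl (h n) \<subseteq> U"
    "\<forall>m n. m \<noteq> n \<longrightarrow> cl (h m) \<inter> cl (h n) = {}" by auto
  then show thesis using that[of h] unfolding rich_sequence_def by simp
qed

text \<open>Each member \<^term>\<open>V\<close> of the system is punctured by a closed set that lies in a term of a sequence
  \<^term>\<open>h\<close> and encodes the code of \<^term>\<open>V\<close>. The sequence is the first one, in a fixed well-order of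
  all sequences, whose terms are almost all inside \<^term>\<open>V\<close>; hence it is eventually constant along an
  increasing chain.\<close>

theorem good_of_code:
  fixes C :: "'c set"
  assumes C: "infinite C" and rich: "\<And>x. x \<in> Y \<Longrightarrow> rich x C"
    and S: "system Y S"
    and code: "\<And>x V. (x, V) \<in> S \<Longrightarrow> code x V \<in> C"
    and noeth: "\<And>c. c \<in> C \<Longrightarrow> noetherian_family {V. \<exists>x. (x, V) \<in> S \<and> code x V = c}"
  shows "good Y"
proof -
  obtain r :: "(nat \<Rightarrow> 'a set) rel" where r: "Well_order r" "Field r = UNIV"
    using well_ordering[where ?'a = "nat \<Rightarrow> 'a set"] by blast
  have an: "antisym r"
    using r by (simp add: well_order_on_def linear_order_on_def partial_order_on_def)
  \<comment> \<open>Tolerating finitely many terms outside \<open>V\<close> makes the condition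
    survive the removal from \<open>V\<close> of a part of one term of \<open>h\<close>.\<close>
  define alm where "alm h V \<longleftrightarrow> rich_sequence C h \<and> finite {n. \<not> cl (h n) \<subseteq> V}" for h V
  have least: "\<exists>h\<in>Q. \<forall>h'\<in>Q. (h, h') \<in> r" if "Q \<noteq> {}" for Q
    using well_order_least[OF r that] by metis
  define hh where "hh V = (SOME h. alm h V \<and> (\<forall>h'. alm h' V \<longrightarrow> (h, h') \<in> r))" for V
  have hh: "alm (hh V) V" "alm h' V \<Longrightarrow> (hh V, h') \<in> r" if xV: "(x, V) \<in> S" for x V h'
  proof -
    obtain h where "rich_sequence C h" "\<And>n. cl (h n) \<subseteq> V"
      using rich_sequence_exists[OF rich[OF systemD(1)[OF S xV]] systemD(3)[OF S xV] systemD(2)[OF S xV]]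
      by blast
    then have "{h. alm h V} \<noteq> {}" unfolding alm_def by auto
    then have "\<exists>h. alm h V \<and> (\<forall>h'. alm h' V \<longrightarrow> (h, h') \<in> r)" using least[of "{h. alm h V}"] by blast
    then have "alm (hh V) V \<and> (\<forall>h'. alm h' V \<longrightarrow> (hh V, h') \<in> r)" unfolding hh_def by (rule someI_ex)
    then show "alm (hh V) V" "alm h' V \<Longrightarrow> (hh V, h') \<in> r" by blast+
  qed
  \<comment> \<open>Almost every \<open>n\<close> qualifies: \<open>x\<close> is in at most one of
    the disjoint closures \<open>cl (hh V n)\<close>.\<close>
  define Q where "Q x V n \<longleftrightarrow> cl (hh V n) \<subseteq> V \<and> x \<notin> cl (hh V n)" for x V n
  have Qex: "\<exists>n. Q x V n" if xV: "(x, V) \<in> S" for x V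
  proof -
    have al: "rich_sequence C (hh V)" "finite {n. \<not> cl (hh V n) \<subseteq> V}"
      using hh(1)[OF xV] unfolding alm_def by blast+
    have "m = n" if "x \<in> cl (hh V m)" "x \<in> cl (hh V n)" for m n
      using al(1) that unfolding rich_sequence_def by blast
    then have "finite {n. x \<in> cl (hh V n)}"
      by (cases "\<exists>m. x \<in> cl (hh V m)") (auto intro: finite_subset[of _ "{_}"])
    then have "finite ({n. x \<in> cl (hh V n)} \<union> {n. \<not> cl (hh V n) \<subseteq> V})" using al(2) by simp
    then obtain n where "n \<notin> {n. x \<in> cl (hh V n)} \<union> {n. \<not> cl (hh V n) \<subseteq> V}"
      using ex_new_if_finite[OF infinite_UNIV_nat] by blast
    then show ?thesis unfolding Q_def by blast
  qed
  define nn where "nn x V = (SOME n. Q x V n)" for x V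
  have nn: "cl (hh V (nn x V)) \<subseteq> V" "x \<notin> cl (hh V (nn x V))" if xV: "(x, V) \<in> S" for x V
    using someI_ex[OF Qex[OF xV]] unfolding nn_def Q_def by blast+
  \<comment> \<open>The antichain is a function of the open set alone, so all neighbourhoods
    punctured in the same term use the same one.\<close>
  define Aa where "Aa H = (SOME A. open_antichain H C A)" for H
  have Aa: "open_antichain (h n) C (Aa (h n))" if "rich_sequence C h" for h n
  proof -
    have "\<exists>A. open_antichain (h n) C A" using that unfolding rich_sequence_def by simp
    then show ?thesis unfolding Aa_def by (rule someI_ex)
  qed
  define K where "K x V = cl (Aa (hh V (nn x V)) (code x V))" for x V
  have hrich: "rich_sequence C (hh V)" if "(x, V) \<in> S" for x V
    using hh(1)[OF that] unfolding alm_def by blast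
  have Ksub: "K x V \<subseteq> cl (hh V (nn x V))" if "(x, V) \<in> S" for x V
    unfolding K_def using open_antichainD(2)[OF Aa[OF hrich[OF that]] code[OF that]] by (rule closure_of_mono)
  have Kne: "K x V \<noteq> {}" if xV: "(x, V) \<in> S" for x V
  proof
    assume "K x V = {}"
    let ?A = "Aa (hh V (nn x V))"
    have A: "open_antichain (hh V (nn x V)) C ?A" using Aa[OF hrich[OF xV]] .
    have "?A (code x V) \<subseteq> K x V" unfolding K_def
      by (rule closure_of_subset[OF openin_subset[OF open_antichainD(1)[OF A code[OF xV]]]])
    then have "?A (code x V) = {}" using \<open>K x V = {}\<close> by blast
    then have "C \<subseteq> {code x V}" using open_antichainD(3)[OF A code[OF xV]] by blast
    then show False using C finite_subset by blast
  qed
  define S' where "S' = {(x, V - K x V) | x V. (x, V) \<in> S}"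
  have "system Y S'"
  proof (rule systemI)
    fix x W assume "(x, W) \<in> S'"
    then obtain V where V: "(x, V) \<in> S" "W = V - K x V" unfolding S'_def by blast
    have "x \<in> V" "openin X V" "x \<in> Y" using systemD(1-3)[OF S V(1)] by blast+
    moreover have "x \<notin> K x V" using Ksub[OF V(1)] nn(2)[OF V(1)] by blast
    moreover have "openin X (V - K x V)" unfolding K_def using \<open>openin X V\<close> by (simp add: openin_diff)
    ultimately show "x \<in> Y \<and> x \<in> W \<and> openin X W" using V(2) by simp
  next
    fix x U assume "x \<in> Y" "openin X U" "x \<in> U"
    then obtain V where "(x, V) \<in> S" "V \<subseteq> U" using systemD(4)[OF S] by blast
    then show "\<exists>V. (x, V) \<in> S' \<and> V \<subseteq> U" unfolding S'_def by blast
  qed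
  moreover have "noetherian_family (snd ` S')"
    unfolding noetherian_family_def
  proof
    assume "\<exists>f :: nat \<Rightarrow> 'a set. (\<forall>n. f n \<in> snd ` S') \<and> (\<forall>n. f n \<subset> f (Suc n))"
    then obtain f :: "nat \<Rightarrow> 'a set" where f: "\<And>i. f i \<in> snd ` S'" "\<And>i. f i \<subset> f (Suc i)" by blast
    have "\<forall>i. \<exists>p. p \<in> S \<and> f i = snd p - K (fst p) (snd p)"
    proof
      fix i
      show "\<exists>p. p \<in> S \<and> f i = snd p - K (fst p) (snd p)" using f(1)[of i] unfolding S'_def by force
    qed
    then obtain p where p: "\<forall>i. p i \<in> S \<and> f i = snd (p i) - K (fst (p i)) (snd (p i))"
      using choice[of "\<lambda>i p. p \<in> S \<and> f i = snd p - K (fst p) (snd p)"] by blast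
    define x where "x i = fst (p i)" for i
    define V where "V i = snd (p i)" for i
    have xV: "(x i, V i) \<in> S" and fi: "f i = V i - K (x i) (V i)" for i
      using p unfolding x_def V_def by simp_all
    have fmono: "f i \<subseteq> f j" if "i \<le> j" for i j using lift_Suc_mono_le[of f i j] f(2) that by blast
    have alm_f: "alm (hh (V i)) (f i)" for i
    proof -
      let ?h = "hh (V i)" and ?n = "nn (x i) (V i)"
      have al: "rich_sequence C ?h" "finite {n. \<not> cl (?h n) \<subseteq> V i}"
        using hh(1)[OF xV] unfolding alm_def by blast+
      have "{n. \<not> cl (?h n) \<subseteq> f i} \<subseteq> insert ?n {n. \<not> cl (?h n) \<subseteq> V i}"
        using al(1) Ksub[OF xV, of i] fi[of i] unfolding rich_sequence_def by blast
      then have "finite {n. \<not> cl (?h n) \<subseteq> f i}" using al(2) finite_subset by blast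
      then show ?thesis using al(1) unfolding alm_def by blast
    qed
    have alm_mono: "alm h W'" if "alm h W" "W \<subseteq> W'" for h W W'
    proof -
      have "{n. \<not> cl (h n) \<subseteq> W'} \<subseteq> {n. \<not> cl (h n) \<subseteq> W}" using that(2) by blast
      then show ?thesis using that(1) finite_subset unfolding alm_def by blast
    qed
    \<comment> \<open>The first sequence that is almost inside some \<open>f i\<close>. Being almost
      inside \<open>f k\<close>, it is also the first one almost inside each later
      \<open>V i\<close>.\<close>
    obtain h where h: "h \<in> {h. \<exists>i. alm h (f i)}" "\<forall>h'\<in>{h. \<exists>i. alm h (f i)}. (h, h') \<in> r"
      using least[of "{h. \<exists>i. alm h (f i)}"] alm_f by blast
    then obtain k where k: "alm h (f k)" by blast
    have hV: "hh (V i) = h" if "k \<le> i" for i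
    proof -
      have "alm h (V i)" using alm_mono[OF k] fmono[OF that] fi[of i] by blast
      then have "(hh (V i), h) \<in> r" using hh(2)[OF xV] by blast
      moreover have "(h, hh (V i)) \<in> r" using h(2) alm_f by blast
      ultimately show ?thesis using an by (simp add: antisym_def)
    qed
    have hr: "rich_sequence C h" using k unfolding alm_def by blast
    define n where "n i = nn (x i) (V i)" for i
    have Kh: "K (x i) (V i) = cl (Aa (h (n i)) (code (x i) (V i)))" if "k \<le> i" for i
      unfolding K_def n_def hV[OF that] ..
    have Ksub': "K (x i) (V i) \<subseteq> cl (h (n i))" "cl (h (n i)) \<subseteq> V i" if "k \<le> i" for i
      using Ksub[OF xV[of i]] nn(1)[OF xV[of i]] hV[OF that] unfolding n_def by simp_all
    \<comment> \<open>The hole \<open>K (x i) (V i)\<close> is a nonempty part of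
      \<open>cl (h (n i))\<close> and misses \<open>f i\<close>, hence also \<open>f k\<close>. Only
      finitely many terms of \<open>h\<close> have closures that leave \<open>f k\<close>, so
      \<open>n\<close> takes one value infinitely often.\<close>
    have "n i \<in> {n. \<not> cl (h n) \<subseteq> f k}" if "k \<le> i" for i
      using fmono[OF that] fi[of i] Ksub'[OF that] Kne[OF xV[of i]] by blast
    then have "n ` {k..} \<subseteq> {n. \<not> cl (h n) \<subseteq> f k}" by auto
    then have fin: "finite (n ` {k..})" using k finite_subset unfolding alm_def by blast
    obtain i0 where i0: "i0 \<in> {k..}" "infinite {i \<in> {k..}. n i = n i0}"
      using pigeonhole_infinite[OF _ fin] infinite_Ici by blast
    define I where "I = {i \<in> {k..}. n i = n i0}"
    define m where "m = n i0"
    have I: "infinite I" "\<And>i. i \<in> I \<Longrightarrow> k \<le> i \<and> n i = m" using i0 unfolding I_def m_def by simp_all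
    have A: "open_antichain (h m) C (Aa (h m))" using Aa[OF hr] .
    \<comment> \<open>The hole of the later index \<open>j\<close> misses \<open>f i\<close> but
      lies in a term contained in \<open>V i\<close>, so it lies in the hole of \<open>i\<close>;
      the antichain then makes the codes agree.\<close>
    have codes: "code (x j) (V j) = code (x i) (V i)" if "i \<in> I" "j \<in> I" "i < j" for i j
    proof -
      have "cl (Aa (h m) (code (x j) (V j))) \<subseteq> cl (Aa (h m) (code (x i) (V i)))"
        using fmono[of i j] that(3) fi[of i] fi[of j] Ksub'[of i] Ksub'[of j] Kh[of i] Kh[of j] I(2)[OF that(1)] I(2)[OF that(2)]
        by auto
      moreover have "Aa (h m) (code (x j) (V j)) \<subseteq> cl (Aa (h m) (code (x j) (V j)))"
        by (rule closure_of_subset[OF openin_subset[OF open_antichainD(1)[OF A code[OF xV]]]])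
      ultimately have "Aa (h m) (code (x j) (V j)) \<subseteq> cl (Aa (h m) (code (x i) (V i)))"
        by (rule subset_trans[rotated])
      then show ?thesis using open_antichainD(3)[OF A code[OF xV] code[OF xV]] by blast
    qed
    obtain a where a: "a \<in> I" using I(1) by (metis finite.emptyI ex_in_conv)
    define c where "c = code (x a) (V a)"
    have cc: "code (x i) (V i) = c" if "i \<in> I" for i
      using codes[OF a that] codes[OF that a] unfolding c_def by (metis linorder_neqE_nat)
    have Vi: "V i = f i \<union> cl (Aa (h m) c)" "f i \<inter> cl (Aa (h m) c) = {}" if "i \<in> I" for i
      using fi[of i] Kh[of i] Ksub'[of i] I(2)[OF that] cc[OF that] by auto
    \<comment> \<open>Restoring the same hole to every \<open>f i\<close> preserves strictness and
      produces a chain within one code class.\<close>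
    have "V i \<subset> V j" if "i \<in> I" "j \<in> I" "i < j" for i j
      using Vi[OF that(1)] Vi[OF that(2)] strict_chain_less[of f, OF f(2) that(3)] by blast
    then have "\<exists>i\<in>I. V i \<notin> {V. \<exists>x. (x, V) \<in> S \<and> code x V = c}"
      using noetherian_familyD[OF noeth I(1), of c V] code[OF xV[of a]] unfolding c_def by blast
    then show False using cc xV by blast
  qed
  ultimately show ?thesis unfolding good_def by blast
qed

text \<open>The union of the systems for the sets \<open>Z c\<close>, restricted to
  \<open>Y\<close>, is a system; the code of a pair is an index \<open>c\<close> whose system
  contains it.\<close>

corollary good_UN:
  assumes C: "infinite C" and rich: "\<And>x. x \<in> Y \<Longrightarrow> rich x C"
    and Y: "Y \<subseteq> (\<Union>c\<in>C. Z c)" and good: "\<And>c. c \<in> C \<Longrightarrow> good (Z c)"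
  shows "good Y"
proof -
  obtain R where R0: "\<forall>c\<in>C. system (Z c) (R c) \<and> noetherian_family (snd ` R c)"
    using bchoice[of C "\<lambda>c R. system (Z c) R \<and> noetherian_family (snd ` R)"] good unfolding good_def by blast
  have R: "system (Z c) (R c)" "noetherian_family (snd ` R c)" if "c \<in> C" for c using R0 that by blast+
  define S where "S = {(x, V). x \<in> Y \<and> (\<exists>c\<in>C. (x, V) \<in> R c)}"
  define code where "code x V = (SOME c. c \<in> C \<and> (x, V) \<in> R c)" for x V
  have code: "code x V \<in> C \<and> (x, V) \<in> R (code x V)" if "(x, V) \<in> S" for x V
    unfolding code_def by (rule someI_ex) (use that in \<open>auto simp: S_def\<close>)
  show ?thesis
  proof (rule good_of_code[OF C rich, of Y S code])
    show "system Y S"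
    proof (rule systemI)
      fix x V assume "(x, V) \<in> S"
      then show "x \<in> Y \<and> x \<in> V \<and> openin X V"
        using systemD(2,3)[OF R(1)] unfolding S_def by blast
    next
      fix x U assume x: "x \<in> Y" "openin X U" "x \<in> U"
      then obtain c where "c \<in> C" "x \<in> Z c" using Y by blast
      then show "\<exists>V. (x, V) \<in> S \<and> V \<subseteq> U" using systemD(4)[OF R(1) _ x(2,3)] x(1) unfolding S_def by blast
    qed
  next
    fix c assume "c \<in> C"
    have "{V. \<exists>x. (x, V) \<in> S \<and> code x V = c} \<subseteq> snd ` R c" using code by force
    then show "noetherian_family {V. \<exists>x. (x, V) \<in> S \<and> code x V = c}"
      using noetherian_family_subset[OF R(2)[OF \<open>c \<in> C\<close>]] by blast
  qed (use code in blast)+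
qed

subsection \<open>Homogeneous open sets\<close>

definition nonempty_open_in :: "'a set \<Rightarrow> 'a set \<Rightarrow> bool" where
  "nonempty_open_in G W \<longleftrightarrow> openin X W \<and> W \<noteq> {} \<and> W \<subseteq> G"

definition pi_base :: "'a set \<Rightarrow> 'a set set \<Rightarrow> bool" where
  "pi_base G P \<longleftrightarrow> (\<forall>p\<in>P. nonempty_open_in G p) \<and> (\<forall>W. nonempty_open_in G W \<longrightarrow> (\<exists>p\<in>P. p \<subseteq> W))"

definition disjoint_open_family :: "'a set \<Rightarrow> 'a set set \<Rightarrow> bool" where
  "disjoint_open_family G D \<longleftrightarrow> (\<forall>W\<in>D. nonempty_open_in G W) \<and> pairwise disjnt D"

text \<open>No nonempty open subset has a \<pi>-base smaller than \<open>P\<close>. Disjoint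
  families are compared one cardinality at a time because the supremum of their cardinalities need
  not be attained.\<close>

definition homogeneous :: "'a set \<Rightarrow> 'a set set \<Rightarrow> bool" where
  "homogeneous G P \<longleftrightarrow> nonempty_open_in G G \<and> pi_base G P \<and>
    (\<forall>W. nonempty_open_in G W \<longrightarrow>
      (\<forall>Q. pi_base W Q \<longrightarrow> |P| \<le>o |Q| ) \<and>
      (\<forall>D. disjoint_open_family G D \<longrightarrow> (\<exists>E. disjoint_open_family W E \<and> |E| =o |D| )))"

text \<open>By \<open>nonsplitting_singleton\<close>, a nonempty open set that fails this is a
  single point.\<close>

definition splits :: "'a set \<Rightarrow> bool" where
  "splits G \<longleftrightarrow> (\<exists>V W. nonempty_open_in G V \<and> nonempty_open_in G W \<and> V \<inter> W = {})"

text \<open>For open \<open>G\<close> these are the regular open subsets of the subspace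
  \<open>G\<close>; the opposite inclusion \<open>W \<subseteq> X interior_of (cl W)\<close> holds
  for every open \<open>W\<close>.\<close>

definition relreg :: "'a set \<Rightarrow> 'a set set" where
  "relreg G = {W. openin X W \<and> W \<subseteq> G \<and> G \<inter> X interior_of (cl W) \<subseteq> W}"

lemma nonempty_open_in_trans: "nonempty_open_in G W \<Longrightarrow> nonempty_open_in W V \<Longrightarrow> nonempty_open_in G V"
  unfolding nonempty_open_in_def by blast

lemma pi_base_restrict:
  assumes "pi_base G P" "G' \<subseteq> G"
  shows "pi_base G' {p \<in> P. p \<subseteq> G'}"
proof -
  have "nonempty_open_in G' p" if "p \<in> P" "p \<subseteq> G'" for p
    using assms(1) that unfolding pi_base_def nonempty_open_in_def by blast
  moreover have "\<exists>p\<in>{p \<in> P. p \<subseteq> G'}. p \<subseteq> W" if W: "nonempty_open_in G' W" for W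
  proof -
    have "nonempty_open_in G W" "W \<subseteq> G'" using W assms(2) unfolding nonempty_open_in_def by blast+
    then show ?thesis using assms(1) unfolding pi_base_def by blast
  qed
  ultimately show ?thesis unfolding pi_base_def by blast
qed

lemma pi_base_all: "pi_base G {W. nonempty_open_in G W}"
  unfolding pi_base_def by blast

lemma homogeneousD:
  assumes "homogeneous G P"
  shows "nonempty_open_in G G" "pi_base G P"
    and "nonempty_open_in G W \<Longrightarrow> pi_base W Q \<Longrightarrow> |P| \<le>o |Q|"
    and "nonempty_open_in G W \<Longrightarrow> disjoint_open_family G D \<Longrightarrow> \<exists>E. disjoint_open_family W E \<and> |E| =o |D|"
  using assms unfolding homogeneous_def by blast+

text \<open>One point from each member bounds \<open>|D|\<close> by the size of the type, and
  Cantor's theorem does the rest. The bound supplies a cardinality that no disjoint family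
  attains.\<close>

lemma disjoint_open_family_card:
  assumes "disjoint_open_family G D"
  shows "|D| <o |UNIV :: 'a set set|"
proof -
  have ne: "\<exists>w. w \<in> W" if "W \<in> D" for W
    using assms that unfolding disjoint_open_family_def nonempty_open_in_def by blast
  define f where "f W = (SOME w. w \<in> W)" for W :: "'a set"
  have f: "f W \<in> W" if "W \<in> D" for W unfolding f_def using ne[OF that] by (rule someI_ex)
  have "inj_on f D"
  proof (rule inj_onI)
    fix V W assume "V \<in> D" "W \<in> D" "f V = f W"
    then have "\<not> disjnt V W" using f[of V] f[of W] unfolding disjnt_def by auto
    then show "V = W"
      using assms \<open>V \<in> D\<close> \<open>W \<in> D\<close> unfolding disjoint_open_family_def pairwise_def by blast
  qed
  then have "|D| \<le>o |UNIV :: 'a set|" by (meson card_of_ordLeq subset_UNIV)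
  moreover have "|UNIV :: 'a set| <o |Pow (UNIV :: 'a set)|" by (rule card_of_Pow)
  ultimately show ?thesis by (simp add: Pow_UNIV ordLeq_ordLess_trans)
qed

text \<open>Two minimisations: first of the size of a \<pi>-base over the nonempty open subsets of
  \<open>U\<close>, then, below the minimiser \<open>G1\<close>, of a cardinality \<open>|K|\<close>
  not attained by disjoint families. Cardinalities attained in \<open>G\<close> are below
  \<open>|K|\<close>, hence attained in every nonempty open subset.\<close>

lemma homogeneous_exists:
  assumes U: "openin X U" "U \<noteq> {}"
  obtains G P where "G \<subseteq> U" "homogeneous G P"
proof -
  have UU: "nonempty_open_in U U" using U unfolding nonempty_open_in_def by blast
  let ?F = "{P. \<exists>G. nonempty_open_in U G \<and> pi_base G P}"
  have "?F \<noteq> {}" using UU pi_base_all by blast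
  from minimal_card_exists[OF this] obtain P where P: "P \<in> ?F" and Pmin: "\<forall>Q\<in>?F. |P| \<le>o |Q|" ..
  from P obtain G1 where G1: "nonempty_open_in U G1" "pi_base G1 P" by blast
  let ?K = "{K :: 'a set set. \<exists>G. nonempty_open_in G1 G \<and> \<not> (\<exists>D. disjoint_open_family G D \<and> |D| =o |K| )}"
  have G11: "nonempty_open_in G1 G1" using G1(1) unfolding nonempty_open_in_def by blast
  have "UNIV \<in> ?K" using G11 disjoint_open_family_card not_ordLess_ordIso by blast
  then have "?K \<noteq> {}" by blast
  from minimal_card_exists[OF this] obtain K where K: "K \<in> ?K" and Kmin: "\<forall>L\<in>?K. |K| \<le>o |L|" ..
  from K obtain G where G: "nonempty_open_in G1 G" and nK: "\<And>D. disjoint_open_family G D \<Longrightarrow> \<not> |D| =o |K|"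
    by blast
  let ?P = "{p \<in> P. p \<subseteq> G}"
  have "homogeneous G ?P"
    unfolding homogeneous_def
  proof (intro conjI allI impI)
    show "nonempty_open_in G G" using G unfolding nonempty_open_in_def by blast
    show "pi_base G ?P" using pi_base_restrict[OF G1(2)] G unfolding nonempty_open_in_def by blast
  next
    fix W Q assume W: "nonempty_open_in G W" and Q: "pi_base W Q"
    have "nonempty_open_in U W" using W G G1(1) nonempty_open_in_trans by blast
    then have "|P| \<le>o |Q|" using Pmin Q by blast
    moreover have "| ?P| \<le>o |P|" by (rule card_of_mono1) blast
    ultimately show "| ?P| \<le>o |Q|" using ordLeq_transitive by blast
  next
    fix W D assume W: "nonempty_open_in G W" and D: "disjoint_open_family G D"
    show "\<exists>E. disjoint_open_family W E \<and> |E| =o |D|"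
    proof (rule ccontr)
      assume "\<not> ?thesis"
      moreover have "nonempty_open_in G1 W" using W G nonempty_open_in_trans by blast
      ultimately have "|K| \<le>o |D|" using Kmin by blast
      then obtain D' where D': "D' \<subseteq> D" "|D'| =o |K|" by (rule subset_of_card)
      have "disjoint_open_family G D'"
        using D D'(1) unfolding disjoint_open_family_def by (meson pairwise_subset subsetD)
      then show False using nK D'(2) by blast
    qed
  qed
  moreover have "G \<subseteq> U" using G G1(1) unfolding nonempty_open_in_def by blast
  ultimately show thesis using that by blast
qed

lemma homogeneous_splits:
  assumes hom: "homogeneous G P" and spl: "splits G" and G': "nonempty_open_in G G'"
  shows "splits G'"
proof -
  obtain V W where VW: "nonempty_open_in G V" "nonempty_open_in G W" "V \<inter> W = {}"
    using spl unfolding splits_def by blast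
  have "V \<noteq> W" using VW unfolding nonempty_open_in_def by blast
  have "disjoint_open_family G {V, W}"
    using VW unfolding disjoint_open_family_def by (auto simp: pairwise_insert disjnt_def)
  then obtain E where E: "disjoint_open_family G' E" "|E| =o |{V, W}|" using homogeneousD(4)[OF hom G'] by blast
  obtain b where "bij_betw b E {V, W}" using E(2) by (rule card_eq_bijE)
  then have "card E = 2" using bij_betw_same_card[of b E "{V, W}"] \<open>V \<noteq> W\<close> by simp
  then obtain A B where AB: "E = {A, B}" "A \<noteq> B" by (auto simp: card_2_iff)
  then have "nonempty_open_in G' A" "nonempty_open_in G' B" "A \<inter> B = {}"
    using E(1) unfolding disjoint_open_family_def by (auto simp: pairwise_insert disjnt_def)
  then show ?thesis unfolding splits_def by blast
qed

text \<open>A minimal member of a finite \<pi>-base would split and so contain a strictly smaller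
  member.\<close>

lemma homogeneous_infinite:
  assumes hom: "homogeneous G P" and spl: "splits G"
  shows "infinite P"
proof
  assume fin: "finite P"
  have pb: "pi_base G P" using homogeneousD(2)[OF hom] .
  have "P \<noteq> {}" using pb homogeneousD(1)[OF hom] unfolding pi_base_def by blast
  then obtain p where p: "p \<in> P" "\<And>q. q \<in> P \<Longrightarrow> q \<subseteq> p \<Longrightarrow> p = q"
    using finite_has_minimal[OF fin] by blast
  have Gp: "nonempty_open_in G p" using pb p(1) unfolding pi_base_def by blast
  obtain V W where VW: "nonempty_open_in p V" "nonempty_open_in p W" "V \<inter> W = {}"
    using homogeneous_splits[OF hom spl Gp] unfolding splits_def by blast
  obtain q where q: "q \<in> P" "q \<subseteq> V"
    using pb nonempty_open_in_trans[OF Gp VW(1)] unfolding pi_base_def by blast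
  have "p = q" using p(2) q VW(1) unfolding nonempty_open_in_def by blast
  then show False using q VW unfolding nonempty_open_in_def by blast
qed

section \<open>Antichains indexed by the regular open subsets of a homogeneous set\<close>

lemma openin_closure_disjoint:
  assumes "openin X V" "V \<inter> W = {}"
  shows "V \<inter> cl W = {}"
  using openin_Int_closure_of_eq_empty[OF assms(1), of W] assms(2) by simp

lemma subset_closure_block:
  assumes "openin X V" "B \<subseteq> V" "B \<subseteq> cl S"
  shows "B \<subseteq> cl (V \<inter> S)"
  using openin_Int_closure_of_subset[OF assms(1), of S] assms(2,3) by blast

text \<open>Fewer than \<^term>\<open>|P|\<close> open sets never form a \<open>\<pi>\<close>-base, so a transfinite recursion of length
  \<^term>\<open>|P|\<close> can avoid containing any of the earlier sets.\<close>

lemma one_sided_antichain: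
  assumes hom: "homogeneous G P" and W: "nonempty_open_in G W"
  obtains f where "\<And>p. p \<in> P \<Longrightarrow> nonempty_open_in W (f p)"
    "\<And>p q. p \<in> P \<Longrightarrow> q \<in> P \<Longrightarrow> (p, q) \<in> |P| \<Longrightarrow> p \<noteq> q \<Longrightarrow> \<not> f p \<subseteq> cl (f q)"
proof -
  have wf: "wf ( |P| - Id)" using card_of_Well_order[of P] by (simp add: well_order_on_def)
  define \<Phi> where "\<Phi> f q V \<longleftrightarrow> q \<in> P \<longrightarrow> nonempty_open_in W V \<and>
      (\<forall>p. (p, q) \<in> |P| - Id \<longrightarrow> \<not> f p \<subseteq> cl V)" for f :: "'a set \<Rightarrow> 'a set" and q V
  have "\<exists>f. \<forall>q. \<Phi> f q (f q)"
  proof (rule dependent_wf_choice[OF wf])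
    fix f g :: "'a set \<Rightarrow> 'a set" and q V
    assume "\<And>z. (z, q) \<in> |P| - Id \<Longrightarrow> f z = g z"
    then show "\<Phi> f q V = \<Phi> g q V" unfolding \<Phi>_def by auto
  next
    fix q and f :: "'a set \<Rightarrow> 'a set" assume IH: "\<And>p. (p, q) \<in> |P| - Id \<Longrightarrow> \<Phi> f p (f p)"
    show "\<exists>V. \<Phi> f q V"
    proof (cases "q \<in> P")
      case True
      let ?F = "f ` underS |P| q"
      have F: "nonempty_open_in W V" if V: "V \<in> ?F" for V
      proof -
        obtain p where p: "V = f p" "(p, q) \<in> |P| - Id" using V unfolding underS_def by blast
        then have "p \<in> P" using Field_card_of[of P] by (auto simp: Field_def)
        then show ?thesis using IH[OF p(2)] p(1) unfolding \<Phi>_def by blast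
      qed
      have "\<not> |P| \<le>o | ?F|"
      proof -
        have "| ?F| <o |P|" using card_of_image[of f "underS |P| q"] card_underS_card_of[OF True]
          by (rule ordLeq_ordLess_trans)
        then show ?thesis using not_ordLess_ordLeq by blast
      qed
      then have "\<not> pi_base W ?F" using homogeneousD(3)[OF hom W] by blast
      then have "\<exists>V. nonempty_open_in W V \<and> (\<forall>p\<in>?F. \<not> p \<subseteq> V)"
        using F unfolding pi_base_def by meson
      then obtain V where V: "nonempty_open_in W V" "\<forall>p\<in>?F. \<not> p \<subseteq> V" by auto
      then obtain x where x: "x \<in> V" unfolding nonempty_open_in_def by blast
      \<comment> \<open>Regularity of the space strengthens "no earlier set lies in
        \<open>V\<close>" to "none lies in \<open>cl V'\<close>".\<close>
      obtain V' where V': "openin X V'" "x \<in> V'" "cl V' \<subseteq> V"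
        using shrink_nbhd[OF _ x] V(1) unfolding nonempty_open_in_def by blast
      have "V' \<subseteq> cl V'" using V'(1) by (simp add: closure_of_subset openin_subset)
      then have "nonempty_open_in W V'" using V' V(1) unfolding nonempty_open_in_def by blast
      moreover have "\<not> f p \<subseteq> cl V'" if "(p, q) \<in> |P| - Id" for p
      proof -
        have "f p \<in> ?F" using that by (auto simp: underS_def)
        then show ?thesis using V(2) V'(3) by blast
      qed
      ultimately show ?thesis unfolding \<Phi>_def by blast
    qed (simp add: \<Phi>_def)
  qed
  then obtain f where f: "\<And>q. \<Phi> f q (f q)" by blast
  show thesis by (rule that[of f]) (use f in \<open>unfold \<Phi>_def, blast+\<close>)
qed

text \<open>In \<open>f p \<union> (W - cl (g p))\<close> the first part excludes an inclusion in one direction of the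
  well-order of \<open>P\<close> and, by complementation, the second part excludes the other.\<close>

lemma pi_base_antichain:
  assumes hom: "homogeneous G P" and spl: "splits G" and G': "nonempty_open_in G G'"
  obtains A where "open_antichain G' P A"
proof -
  obtain V W where VW: "nonempty_open_in G' V" "nonempty_open_in G' W" "V \<inter> W = {}"
    using homogeneous_splits[OF hom spl G'] unfolding splits_def by blast
  obtain f where f: "\<And>p. p \<in> P \<Longrightarrow> nonempty_open_in V (f p)"
    "\<And>p q. p \<in> P \<Longrightarrow> q \<in> P \<Longrightarrow> (p, q) \<in> |P| \<Longrightarrow> p \<noteq> q \<Longrightarrow> \<not> f p \<subseteq> cl (f q)"
    using one_sided_antichain[OF hom nonempty_open_in_trans[OF G' VW(1)]] by blast
  obtain g where g: "\<And>p. p \<in> P \<Longrightarrow> nonempty_open_in W (g p)"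
    "\<And>p q. p \<in> P \<Longrightarrow> q \<in> P \<Longrightarrow> (p, q) \<in> |P| \<Longrightarrow> p \<noteq> q \<Longrightarrow> \<not> g p \<subseteq> cl (g q)"
    using one_sided_antichain[OF hom nonempty_open_in_trans[OF G' VW(2)]] by blast
  have op: "openin X V" "openin X W" "V \<subseteq> G'" "W \<subseteq> G'" using VW unfolding nonempty_open_in_def by blast+
  have fo: "openin X (f p)" "f p \<subseteq> V" and go: "openin X (g p)" "g p \<subseteq> W" if "p \<in> P" for p
    using f(1)[OF that] g(1)[OF that] unfolding nonempty_open_in_def by blast+
  define A where "A p = f p \<union> (W - cl (g p))" for p
  have "open_antichain G' P A"
  proof (rule open_antichainI)
    fix p assume p: "p \<in> P"
    show "openin X (A p)" unfolding A_def using fo[OF p] op by (simp add: openin_Un openin_diff)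
    show "A p \<subseteq> G'" unfolding A_def using fo[OF p] op by blast
  next
    fix p q assume p: "p \<in> P" and q: "q \<in> P" and sub: "A p \<subseteq> cl (A q)"
    have "V \<inter> A q \<subseteq> f q" unfolding A_def using VW(3) by blast
    then have "f p \<subseteq> cl (f q)"
      using subset_closure_block[OF op(1) fo(2)[OF p], of "A q"] closure_of_mono[of "V \<inter> A q" "f q" X] sub
      unfolding A_def by blast
    then have 1: "\<not> ((p, q) \<in> |P| \<and> p \<noteq> q)" using f(2)[OF p q] by blast
    have Wp: "W - cl (g p) \<subseteq> W" by blast
    have "W \<inter> A q \<subseteq> W - cl (g q)" unfolding A_def using VW(3) fo[OF q] by blast
    then have Wc: "W - cl (g p) \<subseteq> cl (W - cl (g q))"
      using subset_closure_block[OF op(2) Wp, of "A q"] closure_of_mono[of "W \<inter> A q" "W - cl (g q)" X] sub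
      unfolding A_def by blast
    have "g q \<subseteq> cl (g q)" using go(1)[OF q] by (simp add: closure_of_subset openin_subset)
    then have "g q \<inter> cl (W - cl (g q)) = {}"
      using openin_closure_disjoint[OF go(1)[OF q], of "W - cl (g q)"] by blast
    then have "g q \<subseteq> cl (g p)" using Wc go(2)[OF q] by blast
    then have 2: "\<not> ((q, p) \<in> |P| \<and> q \<noteq> p)" using g(2)[OF q p] by blast
    have "total_on P |P|" using card_of_Well_order[of P]
      by (simp add: well_order_on_def linear_order_on_def Field_card_of)
    then show "p = q" using 1 2 p q unfolding total_on_def by blast
  qed
  then show thesis using that by blast
qed


text \<open>For \<open>W\<close> in \<open>relreg G\<close>, the union of a maximal disjoint family
  of members of \<open>P\<close> inside \<open>W\<close> is dense in \<open>W\<close>, and its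
  closure determines \<open>W\<close>.\<close>

lemma disjoint_pi_base_code:
  assumes P: "pi_base G P"
  obtains D where "\<And>W. D W \<subseteq> P" "\<And>W. disjoint_open_family G (D W)"
    "\<And>W V. W \<in> relreg G \<Longrightarrow> V \<in> relreg G \<Longrightarrow> D W = D V \<Longrightarrow> W = V"
proof -
  define Q where "Q W D \<longleftrightarrow> D \<subseteq> {p \<in> P. p \<subseteq> W} \<and> pairwise disjnt D \<and>
    (\<forall>p\<in>{p \<in> P. p \<subseteq> W}. p \<noteq> {} \<longrightarrow> (\<exists>d\<in>D. \<not> disjnt p d))" for W D
  have "\<exists>D. Q W D" for W
    unfolding Q_def by (rule maximal_disjoint_subfamily)
  then have "\<exists>D. \<forall>W. Q W (D W)" by (intro choice allI)
  then obtain D where D: "\<And>W. Q W (D W)" by blast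
  have DP: "D W \<subseteq> P" "\<Union>(D W) \<subseteq> W" for W using D[of W] unfolding Q_def by blast+
  have dense: "W \<subseteq> cl (\<Union>(D W))" if W: "W \<in> relreg G" for W
  proof (rule ccontr)
    assume "\<not> W \<subseteq> cl (\<Union>(D W))"
    moreover have "openin X (W - cl (\<Union>(D W)))" using W unfolding relreg_def by (simp add: openin_diff)
    ultimately have "nonempty_open_in G (W - cl (\<Union>(D W)))"
      using W unfolding relreg_def nonempty_open_in_def by blast
    then obtain p where p: "p \<in> P" "p \<subseteq> W - cl (\<Union>(D W))" using P unfolding pi_base_def by blast
    have "p \<noteq> {}" using P p(1) unfolding pi_base_def nonempty_open_in_def by blast
    then obtain d where d: "d \<in> D W" "\<not> disjnt p d" using D[of W] p unfolding Q_def by blast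
    have "openin X d" using P DP(1)[of W] d(1) unfolding pi_base_def nonempty_open_in_def by blast
    then have "d \<subseteq> cl d" by (simp add: closure_of_subset openin_subset)
    also have "cl d \<subseteq> cl (\<Union>(D W))" using d(1) by (intro closure_of_mono) blast
    finally show False using d(2) p(2) unfolding disjnt_def by blast
  qed
  have le: "W \<subseteq> V" if W: "W \<in> relreg G" and V: "V \<in> relreg G" and eq: "D W = D V" for W V
  proof -
    have "W \<subseteq> cl V" using dense[OF W] DP(2)[of V] eq closure_of_mono[of "\<Union>(D V)" V X] by auto
    then have "W \<subseteq> X interior_of (cl V)" using W unfolding relreg_def by (simp add: interior_of_maximal)
    then show ?thesis using W V unfolding relreg_def by blast
  qed
  show thesis
  proof (rule that[of D])
    show "D W \<subseteq> P" for W using DP(1) .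
    show "disjoint_open_family G (D W)" for W
      using D[of W] P unfolding Q_def pi_base_def disjoint_open_family_def by blast
    fix W V assume "W \<in> relreg G" "V \<in> relreg G" "D W = D V"
    then show "W = V" using le[of W V] le[of V W] by simp
  qed
qed

text \<open>A relatively regular open \<open>W\<close> is coded by a disjoint family \<open>D W \<subseteq> P\<close>. The cardinality of
  \<open>D W\<close> is coded in \<open>G1\<close>; a bijection onto \<open>D W\<close> from a disjoint family of that cardinality in \<open>G2\<close>
  is coded by choosing, in each member of the latter, one term of an antichain indexed by \<open>P\<close>.\<close>

theorem relreg_antichain:
  assumes hom: "homogeneous G P" and spl: "splits G" and G': "nonempty_open_in G G'"
  obtains A where "open_antichain G' (relreg G) A"
proof -
  have inf: "infinite P" using homogeneous_infinite[OF hom spl] .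
  have pb: "pi_base G P" using homogeneousD(2)[OF hom] .
  obtain D where D: "\<And>W. D W \<subseteq> P" "\<And>W. disjoint_open_family G (D W)"
    "\<And>W V. W \<in> relreg G \<Longrightarrow> V \<in> relreg G \<Longrightarrow> D W = D V \<Longrightarrow> W = V"
    using disjoint_pi_base_code[OF pb] by metis
  have DP: "|D W| \<le>o |P|" for W using D(1) by (rule card_of_mono1)
  obtain c :: "'a set set \<Rightarrow> 'a set" where c: "\<And>E. |E| \<le>o |P| \<Longrightarrow> c E \<in> P"
    "\<And>E E'. |E| \<le>o |P| \<Longrightarrow> |E'| \<le>o |P| \<Longrightarrow> c E = c E' \<Longrightarrow> |E| =o |E'|"
    using cardinality_code[OF inf, where ?'b = "'a set"] by metis
  obtain G1 G2 where G12: "nonempty_open_in G' G1" "nonempty_open_in G' G2" "G1 \<inter> G2 = {}"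
    using homogeneous_splits[OF hom spl G'] unfolding splits_def by blast
  have op: "openin X G1" "openin X G2" "G1 \<subseteq> G'" "G2 \<subseteq> G'" using G12 unfolding nonempty_open_in_def by blast+
  have GG2: "nonempty_open_in G G2" using nonempty_open_in_trans[OF G' G12(2)] .
  obtain A0 where A0: "open_antichain G1 P A0"
    using pi_base_antichain[OF hom spl nonempty_open_in_trans[OF G' G12(1)]] .
  \<comment> \<open>The family in \<open>G2\<close> depends on the cardinality code \<open>p\<close>
    only, so sets with equal codes are compared on the same family.\<close>
  have "\<exists>E. (\<exists>W. c (D W) = p) \<longrightarrow> disjoint_open_family G2 E \<and> (\<exists>W. c (D W) = p \<and> |E| =o |D W| )" for p
    using homogeneousD(4)[OF hom GG2 D(2)] by metis
  then have "\<exists>E. \<forall>p. (\<exists>W. c (D W) = p) \<longrightarrow>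
      disjoint_open_family G2 (E p) \<and> (\<exists>W. c (D W) = p \<and> |E p| =o |D W| )" by (intro choice allI)
  then obtain E where E: "\<And>p. \<exists>W. c (D W) = p \<Longrightarrow>
      disjoint_open_family G2 (E p) \<and> (\<exists>W. c (D W) = p \<and> |E p| =o |D W| )" by blast
  have Edis: "disjoint_open_family G2 (E (c (D W)))" for W using E by blast
  have "\<exists>b. bij_betw b (E (c (D W))) (D W)" for W
  proof -
    obtain V where "c (D V) = c (D W)" "|E (c (D W))| =o |D V|" using E by blast
    then have "|E (c (D W))| =o |D W|" using c(2)[OF DP DP] ordIso_transitive by blast
    then show ?thesis using card_of_ordIso by blast
  qed
  then have "\<exists>\<beta>. \<forall>W. bij_betw (\<beta> W) (E (c (D W))) (D W)" by (intro choice allI)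
  then obtain \<beta> where \<beta>: "\<And>W. bij_betw (\<beta> W) (E (c (D W))) (D W)" by blast
  have "\<exists>B. nonempty_open_in G q \<longrightarrow> open_antichain q P B" for q
    using pi_base_antichain[OF hom spl] by metis
  then have "\<exists>B. \<forall>q. nonempty_open_in G q \<longrightarrow> open_antichain q P (B q)" by (intro choice allI)
  then obtain B where B: "\<And>q. nonempty_open_in G q \<Longrightarrow> open_antichain q P (B q)" by blast
  have q: "nonempty_open_in G q" "openin X q" "q \<subseteq> G2" if "q \<in> E (c (D W))" for q W
    using Edis[of W] that nonempty_open_in_trans[OF GG2, of q]
    unfolding disjoint_open_family_def nonempty_open_in_def by blast+
  have \<beta>P: "\<beta> W q \<in> P" if "q \<in> E (c (D W))" for q W
    using bij_betwE[OF \<beta>[of W]] that D(1)[of W] by blast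
  define L where "L W = (\<Union>q\<in>E (c (D W)). B q (\<beta> W q))" for W
  have Bq: "openin X (B q (\<beta> W q))" "B q (\<beta> W q) \<subseteq> q" if "q \<in> E (c (D W))" for q W
    using open_antichainD(1,2)[OF B[OF q(1)[OF that]] \<beta>P[OF that]] by blast+
  have L: "openin X (L W)" "L W \<subseteq> G2" for W
    unfolding L_def using Bq q(3) by (blast intro: openin_Union)+
  have A0c: "openin X (A0 (c (D W)))" "A0 (c (D W)) \<subseteq> G1" for W
    using open_antichainD(1,2)[OF A0 c(1)[OF DP]] by blast+
  have "open_antichain G' (relreg G) (\<lambda>W. A0 (c (D W)) \<union> L W)"
  proof (rule open_antichainI)
    fix W
    show "openin X (A0 (c (D W)) \<union> L W)" using A0c L by (simp add: openin_Un)
    show "A0 (c (D W)) \<union> L W \<subseteq> G'" using A0c[of W] L[of W] op by blast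
  next
    fix W V assume W: "W \<in> relreg G" and V: "V \<in> relreg G"
      and sub: "A0 (c (D W)) \<union> L W \<subseteq> cl (A0 (c (D V)) \<union> L V)"
    have 1: "G1 \<inter> (A0 (c (D V)) \<union> L V) \<subseteq> A0 (c (D V))" using L(2)[of V] G12(3) by blast
    have 2: "G2 \<inter> (A0 (c (D V)) \<union> L V) \<subseteq> L V" using A0c(2)[of V] G12(3) by blast
    have "A0 (c (D W)) \<subseteq> cl (A0 (c (D V)))"
      using subset_closure_block[OF op(1) A0c(2)[of W]] sub closure_of_mono[OF 1, of X] by blast
    then have cc: "c (D W) = c (D V)" using open_antichainD(3)[OF A0 c(1)[OF DP] c(1)[OF DP]] by blast
    have LL: "L W \<subseteq> cl (L V)"
      using subset_closure_block[OF op(2) L(2)[of W]] sub closure_of_mono[OF 2, of X] by blast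
    \<comment> \<open>The part in \<open>G1\<close> has made the two families equal. Each member
      \<open>q\<close> is an open block that meets only one piece of \<open>L V\<close>, so the
      bijections can be compared at \<open>q\<close>.\<close>
    have "\<beta> W q = \<beta> V q" if qE: "q \<in> E (c (D W))" for q
    proof -
      have qV: "q \<in> E (c (D V))" using qE cc by simp
      have 3: "q \<inter> L V \<subseteq> B q (\<beta> V q)"
      proof
        fix x assume "x \<in> q \<inter> L V"
        then obtain q' where q': "q' \<in> E (c (D V))" "x \<in> B q' (\<beta> V q')" "x \<in> q" unfolding L_def by blast
        have "\<not> disjnt q q'" using q' Bq(2)[OF q'(1)] unfolding disjnt_def by blast
        then have "q = q'" using Edis[of V] q'(1) qV unfolding disjoint_open_family_def pairwise_def by blast
        then show "x \<in> B q (\<beta> V q)" using q'(2) by simp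
      qed
      have "B q (\<beta> W q) \<subseteq> cl (L V)" using LL qE unfolding L_def by blast
      then have "B q (\<beta> W q) \<subseteq> cl (B q (\<beta> V q))"
        using subset_closure_block[OF q(2)[OF qE] Bq(2)[OF qE]] closure_of_mono[OF 3, of X] by blast
      then show ?thesis using open_antichainD(3)[OF B[OF q(1)[OF qE]] \<beta>P[OF qE] \<beta>P[OF qV]] by blast
    qed
    then have "\<beta> W ` E (c (D W)) = \<beta> V ` E (c (D V))" using cc by (metis image_cong)
    then have "D W = D V" using \<beta>[of W] \<beta>[of V] unfolding bij_betw_def by simp
    then show "W = V" using D(3)[OF W V] by blast
  qed
  then show thesis using that by blast
qed

subsection \<open>Points that are not rich\<close>

definition R :: "'a set" where "R = {x \<in> topspace X. rich x (UNIV :: nat set)}"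

text \<open>Since \<open>{y}\<close> is not open, every neighbourhood of \<open>y\<close> contains
  nonempty open sets with \<open>y\<close> off their closure. A sequence of such sets with disjoint
  closures is an antichain.\<close>

lemma open_antichain_nat:
  assumes W: "openin X W" "y \<in> W" and y: "\<not> openin X {y}"
  obtains A where "open_antichain W (UNIV :: nat set) A"
proof -
  have "\<exists>H. openin X H \<and> cl H \<subseteq> V \<and> y \<notin> cl H \<and> H \<noteq> {}" if V1: "openin X V" and V2: "y \<in> V" for V
  proof -
    have "V \<noteq> {y}" using V1 y by blast
    then obtain z where z: "z \<in> V" "y \<noteq> z" using V2 by blast
    have "y \<in> topspace X" using V1 V2 openin_subset by blast
    then obtain H where "openin X H" "z \<in> H" "cl H \<subseteq> V" "y \<notin> cl H"
      using separate_points[OF V1 z(1) _ z(2)] by blast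
    then show ?thesis by blast
  qed
  then have "\<exists>h :: nat \<Rightarrow> 'a set. (\<forall>n. openin X (h n) \<and> h n \<noteq> {} \<and> cl (h n) \<subseteq> W) \<and>
      (\<forall>m n. m \<noteq> n \<longrightarrow> cl (h m) \<inter> cl (h n) = {})"
    by (rule disjoint_sequence[OF _ W])
  then obtain h :: "nat \<Rightarrow> 'a set" where h: "\<forall>n. openin X (h n) \<and> h n \<noteq> {} \<and> cl (h n) \<subseteq> W"
    "\<forall>m n. m \<noteq> n \<longrightarrow> cl (h m) \<inter> cl (h n) = {}" by auto
  have sub: "h n \<subseteq> cl (h n)" for n using h(1) by (simp add: closure_of_subset openin_subset)
  have "open_antichain W UNIV h"
  proof (rule open_antichainI)
    show "openin X (h n)" for n using h(1) by blast
    show "h n \<subseteq> W" for n using h(1) sub by blast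
    show "m = n" if "h m \<subseteq> cl (h n)" for m n using h sub[of m] that by blast
  qed
  then show thesis using that by blast
qed

text \<open>The isolated points form one relatively discrete set, the other points outside
  \<open>R\<close> a second one: a neighbourhood witnessing that \<open>x\<close> is not rich
  contains no further non-isolated point, since near such a point there would be a countable
  antichain away from \<open>x\<close>.\<close>

lemma good_non_R: "good (topspace X - R)"
proof -
  define I where "I = {x \<in> topspace X. openin X {x}}"
  have "good I"
    by (rule good_discrete) (auto simp: I_def)
  moreover have "good (topspace X - R - I)"
  proof (rule good_discrete)
    fix x assume x: "x \<in> topspace X - R - I"
    then have "\<not> rich x (UNIV :: nat set)" unfolding R_def by blast
    then obtain U where U: "openin X U" "x \<in> U"
      and no: "\<And>H A. openin X H \<Longrightarrow> H \<subseteq> U \<Longrightarrow> x \<notin> cl H \<Longrightarrow> \<not> open_antichain H (UNIV :: nat set) A"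
      unfolding rich_def by blast
    have "y = x" if y: "y \<in> U" "y \<in> topspace X - R - I" for y
    proof (rule ccontr)
      assume "y \<noteq> x"
      then obtain W where W: "openin X W" "y \<in> W" "cl W \<subseteq> U" "x \<notin> cl W"
        using separate_points[OF U(1) y(1), of x] x by blast
      have "\<not> openin X {y}" using y unfolding I_def by blast
      then obtain A where "open_antichain W (UNIV :: nat set) A"
        using open_antichain_nat[OF W(1,2)] by blast
      moreover have "W \<subseteq> U" using W(1,3) closure_of_subset[of W X] openin_subset by blast
      ultimately show False using no W by blast
    qed
    then show "\<exists>U. openin X U \<and> U \<inter> (topspace X - R - I) = {x}" using U x by blast
  qed
  ultimately have "good (I \<union> (topspace X - R - I))" by (rule good_Un)
  then show ?thesis by (rule good_subset) blast
qed

lemma noetherian_base_of_good: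
  assumes "good (topspace X)"
  shows "\<exists>\<B>. noetherian_base X \<B>"
proof -
  obtain S where S: "system (topspace X) S" "noetherian_family (snd ` S)"
    using assms unfolding good_def by blast
  have "is_base X (snd ` S)"
    unfolding is_base_def
  proof (intro conjI ballI allI impI)
    show "openin X V" if "V \<in> snd ` S" for V using that systemD(3)[OF S(1)] by force
    fix U assume U: "openin X U"
    have "\<Union>{V \<in> snd ` S. V \<subseteq> U} = U"
    proof
      show "U \<subseteq> \<Union>{V \<in> snd ` S. V \<subseteq> U}"
      proof
        fix x assume x: "x \<in> U"
        then have "x \<in> topspace X" using U openin_subset by blast
        then obtain V where V: "(x, V) \<in> S" "V \<subseteq> U" using systemD(4)[OF S(1) _ U x] by blast
        then have "V \<in> {V \<in> snd ` S. V \<subseteq> U}" by force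
        then show "x \<in> \<Union>{V \<in> snd ` S. V \<subseteq> U}" using systemD(2)[OF S(1) V(1)] by blast
      qed
    qed blast
    then show "\<exists>\<C>\<subseteq>snd ` S. \<Union>\<C> = U" by (intro exI[of _ "{V \<in> snd ` S. V \<subseteq> U}"]) auto
  qed
  then show ?thesis using S(2) unfolding noetherian_base_def by blast
qed

end

section \<open>Disjoint homogeneous cells\<close>

text \<open>Cells are indexed by points in them, so \<open>D\<close> is a subset of the space and
  the induction over subsets of the space reaches it.\<close>

locale t3_cells = t3 X for X :: "'a topology" +
  fixes D :: "'a set" and G :: "'a \<Rightarrow> 'a set" and P :: "'a \<Rightarrow> 'a set set"
  assumes cell_point: "d \<in> D \<Longrightarrow> d \<in> G d"
    and cell_hom: "d \<in> D \<Longrightarrow> homogeneous (G d) (P d)"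
    and cell_disjoint: "d \<in> D \<Longrightarrow> e \<in> D \<Longrightarrow> d \<noteq> e \<Longrightarrow> G d \<inter> G e = {}"
    and cell_dense: "openin X U \<Longrightarrow> U \<noteq> {} \<Longrightarrow> \<exists>d\<in>D. G d \<inter> U \<noteq> {}"

lemma (in t3) cells_exist: "\<exists>D G P. t3_cells X D G P"
proof -
  obtain F where F: "F \<subseteq> {G. \<exists>P. homogeneous G P}" "pairwise disjnt F"
    "\<forall>p\<in>{G. \<exists>P. homogeneous G P}. p \<noteq> {} \<longrightarrow> (\<exists>d\<in>F. \<not> disjnt p d)"
    using maximal_disjoint_subfamily[of "{G. \<exists>P. homogeneous G P}"] by auto
  have ne: "\<exists>x. x \<in> W" if "W \<in> F" for W
    using F(1) that homogeneousD(1) unfolding nonempty_open_in_def by blast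
  define pt where "pt W = (SOME x. x \<in> W)" for W :: "'a set"
  have pt: "pt W \<in> W" if "W \<in> F" for W unfolding pt_def using ne[OF that] by (rule someI_ex)
  have dis: "V = W" if "V \<in> F" "W \<in> F" "x \<in> V" "x \<in> W" for V W x
    using F(2) that unfolding pairwise_def disjnt_def by blast
  have inj: "inj_on pt F"
    by (rule inj_onI) (metis dis pt)
  define G where "G = inv_into F pt"
  define P where "P d = (SOME P. homogeneous (G d) P)" for d
  have G: "G d \<in> F" "d \<in> G d" if "d \<in> pt ` F" for d
    using that inv_into_into[of d pt F] f_inv_into_f[of d pt F] pt unfolding G_def by metis+
  have hom: "homogeneous (G d) (P d)" if "d \<in> pt ` F" for d
    unfolding P_def by (rule someI_ex) (use F(1) G(1)[OF that] in blast)
  have "t3_cells X (pt ` F) G P"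
  proof
    fix d e assume d: "d \<in> pt ` F" and e: "e \<in> pt ` F" and "d \<noteq> e"
    have "d = pt (G d)" "e = pt (G e)" using d e f_inv_into_f[of _ pt F] unfolding G_def by metis+
    then have "G d \<noteq> G e" using \<open>d \<noteq> e\<close> by metis
    then show "G d \<inter> G e = {}" using dis[OF G(1)[OF d] G(1)[OF e]] by blast
  next
    fix U assume "openin X U" "U \<noteq> {}"
    then obtain W Q where W: "W \<subseteq> U" "homogeneous W Q" by (rule homogeneous_exists) blast
    have "W \<noteq> {}" using homogeneousD(1)[OF W(2)] unfolding nonempty_open_in_def by blast
    then obtain V where V: "V \<in> F" "\<not> disjnt W V" using F(3) W(2) by blast
    have "G (pt V) = V" using inv_into_f_f[OF inj V(1)] unfolding G_def .
    then show "\<exists>d\<in>pt ` F. G d \<inter> U \<noteq> {}" using V W(1) unfolding disjnt_def by blast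
  qed (use G hom in auto)
  then show ?thesis by blast
qed

context t3_cells
begin

section \<open>Regular open sets and their traces on the cells\<close>

definition J :: "'a set \<Rightarrow> 'a set" where "J U = {d \<in> D. G d \<inter> U \<noteq> {}}"

definition M :: "'a set" where "M = {d. splits (G d)}"

text \<open>The product runs over the cells that split. A cell that does not split is a point, and
  there \<open>J V\<close> alone decides the trace of \<open>V\<close>.\<close>

definition traces :: "'a set \<Rightarrow> ('a \<Rightarrow> 'a set) set" where
  "traces K = (\<Pi>\<^sub>E d\<in>K \<inter> M. relreg (G d))"

definition trace :: "'a set \<Rightarrow> 'a \<Rightarrow> 'a set" where
  "trace V = (\<lambda>d\<in>J V \<inter> M. V \<inter> G d)"

lemma cell_open: "d \<in> D \<Longrightarrow> openin X (G d)"
  using homogeneousD(1)[OF cell_hom] unfolding nonempty_open_in_def by blast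

lemma D_subset: "D \<subseteq> topspace X"
  using cell_point cell_open openin_subset by blast

lemma J_mono: "U \<subseteq> V \<Longrightarrow> J U \<subseteq> J V"
  unfolding J_def by blast

lemma J_subset: "J U \<subseteq> D"
  unfolding J_def by blast

lemma trace_in_traces:
  assumes "openin X V" "V = X interior_of (cl V)"
  shows "trace V \<in> traces (J V)"
proof -
  have "V \<inter> G d \<in> relreg (G d)" if "d \<in> J V" for d
  proof -
    have "X interior_of (cl (V \<inter> G d)) \<subseteq> X interior_of (cl V)"
      by (intro interior_of_mono closure_of_mono) blast
    then have "G d \<inter> X interior_of (cl (V \<inter> G d)) \<subseteq> V \<inter> G d" using assms(2) by blast
    moreover have "openin X (V \<inter> G d)" using assms(1) cell_open that J_subset by (intro openin_Int) auto
    ultimately show ?thesis unfolding relreg_def by blast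
  qed
  then show ?thesis unfolding trace_def traces_def by auto
qed

lemma nonsplitting_singleton:
  assumes G: "openin X W" "\<not> splits W" "x \<in> W"
  shows "W = {x}"
proof (rule ccontr)
  assume "W \<noteq> {x}"
  then obtain y where y: "y \<in> W" "x \<noteq> y" using G(3) by blast
  have "x \<in> topspace X" using G openin_subset by blast
  then obtain V where V: "openin X V" "y \<in> V" "cl V \<subseteq> W" "x \<notin> cl V"
    using separate_points[OF G(1) y(1) _ y(2)] by blast
  have sub: "V \<subseteq> cl V" using V(1) by (simp add: closure_of_subset openin_subset)
  have "nonempty_open_in W V" using V sub unfolding nonempty_open_in_def by blast
  moreover have "nonempty_open_in W (W - cl V)"
    using V(4) G unfolding nonempty_open_in_def by (auto simp: openin_diff)
  moreover have "V \<inter> (W - cl V) = {}" using sub by blast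
  ultimately show False using G(2) unfolding splits_def by blast
qed

text \<open>Both sets agree on every cell. As the cells are dense, each set lies in the closure of
  the other, and regularity turns this into inclusion.\<close>

lemma regular_open_determined:
  assumes U: "openin X U" "U = X interior_of (cl U)" and V: "openin X V" "V = X interior_of (cl V)"
    and J: "J U = J V" and tr: "trace U = trace V"
  shows "U = V"
proof -
  have eq: "U \<inter> G d = V \<inter> G d" if d: "d \<in> D" for d
  proof -
    consider "d \<notin> J U" | "d \<in> J U" "d \<notin> M" | "d \<in> J U" "d \<in> M" by blast
    then show ?thesis
    proof cases
      case 1
      then show ?thesis using J d unfolding J_def by blast
    next
      case 2
      then have "G d = {d}" using nonsplitting_singleton[OF cell_open[OF d] _ cell_point[OF d]] unfolding M_def by blast
      moreover have "d \<in> J V" using 2 J by simp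
      ultimately show ?thesis using 2 unfolding J_def by auto
    next
      case 3
      then show ?thesis using fun_cong[OF tr, of d] J unfolding trace_def by auto
    qed
  qed
  have sub: "A \<subseteq> B" if A: "openin X A" and B: "openin X B" "B = X interior_of (cl B)"
    and e: "\<And>d. d \<in> D \<Longrightarrow> A \<inter> G d = B \<inter> G d" for A B
  proof -
    have "A \<subseteq> cl B"
    proof (rule ccontr)
      assume "\<not> A \<subseteq> cl B"
      moreover have "openin X (A - cl B)" using A by (simp add: openin_diff)
      ultimately obtain d where d: "d \<in> D" "G d \<inter> (A - cl B) \<noteq> {}" using cell_dense[of "A - cl B"] by blast
      have "B \<subseteq> cl B" using B(1) by (simp add: closure_of_subset openin_subset)
      then show False using d e[OF d(1)] by blast
    qed
    then show "A \<subseteq> B" using A B(2) interior_of_maximal[of A "cl B" X] by simp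
  qed
  show ?thesis using sub[OF U(1) V eq] sub[OF V(1) U eq[symmetric]] by blast
qed

lemma antichain_of_blocks:
  assumes g: "\<And>d. d \<in> K \<Longrightarrow> openin X (g d)" "\<And>d e. d \<in> K \<Longrightarrow> e \<in> K \<Longrightarrow> d \<noteq> e \<Longrightarrow> g d \<inter> g e = {}"
    and AB: "\<And>d. d \<in> K \<Longrightarrow> A d \<subseteq> g d" "\<And>d. d \<in> K \<Longrightarrow> B d \<subseteq> g d"
    and sub: "(\<Union>d\<in>K. A d) \<subseteq> cl (\<Union>d\<in>K. B d)" and d: "d \<in> K"
  shows "A d \<subseteq> cl (B d)"
proof -
  have 1: "g d \<inter> (\<Union>d\<in>K. B d) \<subseteq> B d" using g(2)[OF d] AB(2) by blast
  have "A d \<subseteq> cl (\<Union>d\<in>K. B d)" using sub d by blast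
  then show ?thesis
    using subset_closure_block[OF g(1)[OF d] AB(1)[OF d]] closure_of_mono[OF 1, of X] by blast
qed

text \<open>For every splitting cell that \<open>H\<close> meets, \<open>H \<inter> G d\<close>
  contains an antichain indexed by the regular open subsets of the whole cell; choosing one term per
  cell realises the product.\<close>

lemma traces_antichain:
  assumes H: "openin X H"
  obtains A where "open_antichain H (traces (J H)) A"
proof -
  have "\<exists>B. d \<in> J H \<inter> M \<longrightarrow> open_antichain (H \<inter> G d) (relreg (G d)) B" for d
  proof (cases "d \<in> J H \<inter> M")
    case True
    then have "d \<in> D" "nonempty_open_in (G d) (H \<inter> G d)" "splits (G d)"
      using H cell_open unfolding J_def M_def nonempty_open_in_def by auto
    then show ?thesis using relreg_antichain[OF cell_hom] by metis
  qed blast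
  then have "\<exists>B. \<forall>d. d \<in> J H \<inter> M \<longrightarrow> open_antichain (H \<inter> G d) (relreg (G d)) (B d)" by (intro choice allI)
  then obtain B where B: "\<And>d. d \<in> J H \<inter> M \<Longrightarrow> open_antichain (H \<inter> G d) (relreg (G d)) (B d)" by blast
  have Bd: "openin X (B d (\<pi> d))" "B d (\<pi> d) \<subseteq> H \<inter> G d" "\<pi> d \<in> relreg (G d)"
    if "\<pi> \<in> traces (J H)" "d \<in> J H \<inter> M" for \<pi> d
  proof -
    show "\<pi> d \<in> relreg (G d)" using that unfolding traces_def by (rule PiE_mem)
    then show "openin X (B d (\<pi> d))" "B d (\<pi> d) \<subseteq> H \<inter> G d"
      using open_antichainD(1,2)[OF B[OF that(2)]] by blast+
  qed
  have "open_antichain H (traces (J H)) (\<lambda>\<pi>. \<Union>d\<in>J H \<inter> M. B d (\<pi> d))"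
  proof (rule open_antichainI)
    fix \<pi> assume \<pi>: "\<pi> \<in> traces (J H)"
    show "openin X (\<Union>d\<in>J H \<inter> M. B d (\<pi> d))" using Bd(1)[OF \<pi>] by (intro openin_Union) blast
    show "(\<Union>d\<in>J H \<inter> M. B d (\<pi> d)) \<subseteq> H" using Bd(2)[OF \<pi>] by blast
  next
    fix \<pi> \<rho> assume \<pi>: "\<pi> \<in> traces (J H)" and \<rho>: "\<rho> \<in> traces (J H)"
      and sub: "(\<Union>d\<in>J H \<inter> M. B d (\<pi> d)) \<subseteq> cl (\<Union>d\<in>J H \<inter> M. B d (\<rho> d))"
    have eq: "\<pi> d = \<rho> d" if d: "d \<in> J H \<inter> M" for d
    proof -
      have "B d (\<pi> d) \<subseteq> cl (B d (\<rho> d))"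
      proof (rule antichain_of_blocks[OF _ _ _ _ sub d, where g = G])
        show "openin X (G d)" if "d \<in> J H \<inter> M" for d using cell_open that J_subset by blast
        show "G d \<inter> G e = {}" if "d \<in> J H \<inter> M" "e \<in> J H \<inter> M" "d \<noteq> e" for d e
          using cell_disjoint[of d e] that J_subset by blast
        show "B d (\<pi> d) \<subseteq> G d" "B d (\<rho> d) \<subseteq> G d" if "d \<in> J H \<inter> M" for d
          using Bd(2)[OF \<pi> that] Bd(2)[OF \<rho> that] by blast+
      qed
      then show ?thesis using open_antichainD(3)[OF B[OF d] Bd(3)[OF \<pi> d] Bd(3)[OF \<rho> d]] by blast
    qed
    show "\<pi> = \<rho>" using \<pi> \<rho> eq unfolding traces_def by (rule PiE_ext)
  qed
  then show thesis using that by blast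
qed

text \<open>Among \<open>T \<times> UNIV\<close> many cells, \<open>S \<subseteq> T\<close> selects \<open>(t, t \<in> S)\<close> for every \<open>t\<close>, so that both
  membership and non-membership are visible in the cells met.\<close>

lemma Pow_antichain:
  fixes T :: "'c set"
  assumes H: "openin X H" and T: "infinite T" "|T| \<le>o |J H|"
  obtains A where "open_antichain H (Pow T) A"
proof -
  obtain i :: "'c \<times> bool \<Rightarrow> 'a" where i: "inj_on i (T \<times> UNIV)" "i ` (T \<times> UNIV) \<subseteq> J H"
    by (rule infinite_doubling[OF T])
  have iJ: "i (t, b) \<in> J H" if "t \<in> T" for t b using i(2) that by blast
  define A where "A S = (\<Union>t\<in>T. H \<inter> G (i (t, t \<in> S)))" for S
  have op: "openin X (H \<inter> G (i (t, b)))" if "t \<in> T" for t b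
    using H cell_open iJ[OF that] J_subset by (intro openin_Int) auto
  have mem: "t \<in> S \<longleftrightarrow> t \<in> S'" if sub: "A S \<subseteq> cl (A S')" and t: "t \<in> T" for S S' t
  proof -
    let ?d = "i (t, t \<in> S)"
    have "H \<inter> G ?d \<noteq> {}" using iJ[OF t] unfolding J_def by blast
    moreover have "H \<inter> G ?d \<subseteq> cl (A S')" using sub t unfolding A_def by blast
    ultimately have "(H \<inter> G ?d) \<inter> A S' \<noteq> {}"
      using openin_closure_disjoint[OF op[OF t, of "t \<in> S"], of "A S'"] by blast
    then obtain t' where t': "t' \<in> T" "G ?d \<inter> G (i (t', t' \<in> S')) \<noteq> {}" unfolding A_def by blast
    have "?d = i (t', t' \<in> S')" using cell_disjoint t'(2) iJ[OF t] iJ[OF t'(1)] J_subset by blast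
    then have "(t, t \<in> S) = (t', t' \<in> S')" using inj_onD[OF i(1)] t t'(1) by blast
    then show ?thesis by auto
  qed
  have "open_antichain H (Pow T) A"
  proof (rule open_antichainI)
    show "openin X (A S)" for S unfolding A_def using op by (intro openin_Union) blast
    show "A S \<subseteq> H" for S unfolding A_def by blast
    show "S = S'" if "S \<in> Pow T" "S' \<in> Pow T" "A S \<subseteq> cl (A S')" for S S'
      using mem[OF that(3)] that(1,2) by blast
  qed
  then show thesis using that by blast
qed

section \<open>Small points and induction on the number of cells\<close>

definition qrich :: "'a set \<Rightarrow> 'a \<Rightarrow> bool" where
  "qrich T x \<longleftrightarrow> (\<forall>U. openin X U \<and> x \<in> U \<longrightarrow>
    (\<exists>H. openin X H \<and> H \<subseteq> U \<and> x \<notin> cl H \<and> |T| \<le>o |J H| ))"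

definition locally_le :: "'a set \<Rightarrow> 'a \<Rightarrow> bool" where
  "locally_le T x \<longleftrightarrow> (\<exists>U. openin X U \<and> x \<in> U \<and> |J U| \<le>o |T| )"

text \<open>A point of \<open>R\<close> that is not small for \<open>T\<close> is
  \<open>qrich T\<close> and, by \<open>rich_code_set\<close>, rich for
  \<open>Pow T \<times> UNIV\<close>. The inductive step relies on this for points not small for a
  smaller set.\<close>

definition small :: "'a set \<Rightarrow> 'a \<Rightarrow> bool" where
  "small T x \<longleftrightarrow> locally_le T x \<or> \<not> qrich T x"

lemma small_mono:
  assumes "small S x" "|S| \<le>o |T|"
  shows "small T x"
proof -
  have "locally_le T x" if "locally_le S x"
    using that assms(2) ordLeq_transitive unfolding locally_le_def by blast
  moreover have "qrich S x" if q: "qrich T x"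
    unfolding qrich_def
  proof (intro allI impI)
    fix U assume "openin X U \<and> x \<in> U"
    then obtain H where "openin X H" "H \<subseteq> U" "x \<notin> cl H" "|T| \<le>o |J H|"
      using q unfolding qrich_def by blast
    then show "\<exists>H. openin X H \<and> H \<subseteq> U \<and> x \<notin> cl H \<and> |S| \<le>o |J H|"
      using ordLeq_transitive[OF assms(2)] by blast
  qed
  ultimately show ?thesis using assms(1) unfolding small_def by blast
qed

text \<open>A finite \<open>Pow T\<close> is covered by the richness for \<open>nat\<close> that
  defines \<open>R\<close>, an infinite one by \<open>Pow_antichain\<close>. The product is the
  colour set of \<open>antichain_colouring\<close>.\<close>

lemma rich_code_set:
  assumes x: "x \<in> R" "qrich T x"
  shows "rich x (Pow T \<times> (UNIV :: nat set))"
proof -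
  have nat: "rich x (UNIV :: nat set)" using x(1) unfolding R_def by blast
  have "rich x (Pow T)"
  proof (cases "finite T")
    case True
    then have "|Pow T| \<le>o |UNIV :: nat set|"
      by (intro ordLess_imp_ordLeq finite_ordLess_infinite[OF card_of_Well_order card_of_Well_order])
        (simp_all add: Field_card_of)
    then show ?thesis using rich_ordLeq[OF nat] by blast
  next
    case False
    show ?thesis
      unfolding rich_def
    proof (intro allI impI)
      fix U assume "openin X U \<and> x \<in> U"
      then obtain H where H: "openin X H" "H \<subseteq> U" "x \<notin> cl H" "|T| \<le>o |J H|"
        using x(2) unfolding qrich_def by blast
      obtain A where "open_antichain H (Pow T) A" using Pow_antichain[OF H(1) False H(4)] .
      then show "\<exists>H A. openin X H \<and> H \<subseteq> U \<and> x \<notin> cl H \<and> open_antichain H (Pow T) A"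
        using H by blast
    qed
  qed
  then show ?thesis using nat by (rule rich_Times)
qed

lemma infinite_code_set: "infinite (Pow T \<times> (UNIV :: nat set))"
  using finite_cartesian_productD2[of "Pow T" "UNIV :: nat set"] by auto

lemma traces_nonempty: "traces K \<noteq> {}"
proof -
  have "{} \<in> relreg (G d)" for d unfolding relreg_def by simp
  then show ?thesis unfolding traces_def by (auto simp: PiE_eq_empty_iff)
qed

lemma traces_mono:
  assumes "K \<subseteq> L"
  shows "|traces K| \<le>o |traces L|"
proof -
  have e: "{} \<in> relreg (G d)" for d unfolding relreg_def by simp
  define F where "F \<pi> = (\<lambda>d\<in>L \<inter> M. if d \<in> K then \<pi> d else {})" for \<pi> :: "'a \<Rightarrow> 'a set"
  have "F \<pi> \<in> traces L" if "\<pi> \<in> traces K" for \<pi>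
    using that e assms unfolding F_def traces_def by (auto simp: PiE_iff)
  moreover have "inj_on F (traces K)"
  proof (rule inj_onI)
    fix \<pi> \<rho> assume \<pi>: "\<pi> \<in> traces K" and \<rho>: "\<rho> \<in> traces K" and eq: "F \<pi> = F \<rho>"
    have "\<pi> d = \<rho> d" if "d \<in> K \<inter> M" for d
      using fun_cong[OF eq, of d] that assms unfolding F_def by (auto split: if_splits)
    with \<pi> \<rho> show "\<pi> = \<rho>" unfolding traces_def by (rule PiE_ext)
  qed
  ultimately show ?thesis by (intro card_of_ordLeqI)
qed

text \<open>If \<open>U\<close> witnesses that \<open>x\<close> is not \<open>qrich T\<close>, any
  other point \<open>y\<close> of the set in \<open>U\<close> has a neighbourhood \<open>W\<close>
  with closure off \<open>x\<close> and so with \<open>|J W| <o |T|\<close>. Then \<open>y\<close>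
  is small for \<open>J W\<close> and excluded, which makes the set relatively discrete.\<close>

lemma good_not_qrich:
  "good {x \<in> R. \<not> qrich T x \<and> (\<forall>S\<subseteq>topspace X. |S| <o |T| \<longrightarrow> \<not> small S x)}" (is "good ?Y")
proof (rule good_discrete)
  fix x assume x: "x \<in> ?Y"
  then obtain U where U: "openin X U" "x \<in> U"
    and no: "\<And>H. openin X H \<Longrightarrow> H \<subseteq> U \<Longrightarrow> x \<notin> cl H \<Longrightarrow> \<not> |T| \<le>o |J H|"
    unfolding qrich_def by blast
  have "y = x" if y: "y \<in> U" "y \<in> ?Y" for y
  proof (rule ccontr)
    assume "y \<noteq> x"
    then obtain W where W: "openin X W" "y \<in> W" "cl W \<subseteq> U" "x \<notin> cl W"
      using separate_points[OF U(1) y(1), of x] x unfolding R_def by blast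
    have "W \<subseteq> U" using W(1,3) closure_of_subset[of W X] openin_subset by blast
    then have less: "|J W| <o |T|" using no[OF W(1) _ W(4)] card_less_or_le by blast
    have "small (J W) y" unfolding small_def locally_le_def using W(1,2) card_of_mono1 by blast
    then show False using y(2) less J_subset D_subset by blast
  qed
  then show "\<exists>U. openin X U \<and> U \<inter> ?Y = {x}" using U x by blast
qed


definition regular_nbhds :: "'a set \<Rightarrow> ('a \<Rightarrow> 'a set) \<Rightarrow> ('a \<times> 'a set) set" where
  "regular_nbhds Y u = {(x, V). x \<in> Y \<and> x \<in> V \<and> openin X V \<and> V = X interior_of (cl V) \<and> V \<subseteq> u x}"

lemma system_regular_nbhds:
  assumes "\<And>x. x \<in> Y \<Longrightarrow> openin X (u x) \<and> x \<in> u x"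
  shows "system Y (regular_nbhds Y u)"
proof (rule systemI)
  fix x U assume x: "x \<in> Y" and U: "openin X U" "x \<in> U"
  have "openin X (U \<inter> u x)" "x \<in> U \<inter> u x" using U assms[OF x] by (simp_all add: openin_Int)
  then obtain W where W: "openin X W" "x \<in> W" "cl W \<subseteq> U \<inter> u x" by (rule shrink_nbhd)
  let ?V = "X interior_of (cl W)"
  have "W \<subseteq> ?V" using W(1) by (simp add: interior_of_maximal closure_of_subset openin_subset)
  moreover have "?V \<subseteq> cl W" by (rule interior_of_subset)
  moreover have "?V = X interior_of (cl ?V)"
  proof
    show "?V \<subseteq> X interior_of (cl ?V)"
      by (rule interior_of_maximal) (simp_all add: closure_of_subset interior_of_subset_topspace)
    have "cl ?V \<subseteq> cl W" by (rule closure_of_minimal) (simp_all add: interior_of_subset)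
    then show "X interior_of (cl ?V) \<subseteq> ?V" by (rule interior_of_mono)
  qed
  ultimately have "(x, ?V) \<in> regular_nbhds Y u" "?V \<subseteq> U"
    using x W unfolding regular_nbhds_def by auto
  then show "\<exists>V. (x, V) \<in> regular_nbhds Y u \<and> V \<subseteq> U" by blast
qed (auto simp: regular_nbhds_def)

text \<open>The code of \<open>V\<close> is the colour of \<open>J V\<close> together with the trace
  of \<open>V\<close>, embedded into \<open>traces L\<close>. For nested sets, equal colours force
  equal \<open>J\<close>, and then equal traces force equal sets; so each code class is an
  antichain.\<close>

lemma good_exact_traces_rich:
  assumes E: "\<And>x. x \<in> E \<Longrightarrow> x \<in> R \<and> qrich T x \<and> rich x (traces L)"
    and u: "\<And>x. x \<in> E \<Longrightarrow> openin X (u x) \<and> x \<in> u x \<and> |J (u x)| \<le>o |T|"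
    and tr: "\<And>x V. x \<in> E \<Longrightarrow> x \<in> V \<Longrightarrow> openin X V \<Longrightarrow> V \<subseteq> u x \<Longrightarrow> |traces (J V)| \<le>o |traces L|"
  shows "good E"
proof -
  obtain c :: "'a set \<Rightarrow> 'a set \<times> nat" where c: "\<And>A. |A| \<le>o |T| \<Longrightarrow> c A \<in> Pow T \<times> UNIV"
    "\<And>A B. A \<subseteq> B \<Longrightarrow> |B| \<le>o |T| \<Longrightarrow> c A = c B \<Longrightarrow> A = B"
    using antichain_colouring[where ?'b = 'a and T = T] by metis
  have "\<exists>\<phi>. |traces K| \<le>o |traces L| \<longrightarrow> inj_on \<phi> (traces K) \<and> \<phi> ` traces K \<subseteq> traces L" for K
    using card_of_ordLeq by metis
  then have "\<exists>\<phi>. \<forall>K. |traces K| \<le>o |traces L| \<longrightarrow> inj_on (\<phi> K) (traces K) \<and> \<phi> K ` traces K \<subseteq> traces L"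
    by (intro choice allI)
  then obtain \<phi> where \<phi>0: "\<forall>K. |traces K| \<le>o |traces L| \<longrightarrow>
      inj_on (\<phi> K) (traces K) \<and> \<phi> K ` traces K \<subseteq> traces L" ..
  have \<phi>: "inj_on (\<phi> K) (traces K)" "\<phi> K ` traces K \<subseteq> traces L" if "|traces K| \<le>o |traces L|" for K
    using \<phi>0 that by blast+
  let ?S = "regular_nbhds E u"
  let ?code = "\<lambda>x V. (c (J V), \<phi> (J V) (trace V))"
  have S: "x \<in> E" "|J V| \<le>o |T|" "openin X V" "V = X interior_of (cl V)" "trace V \<in> traces (J V)"
    "|traces (J V)| \<le>o |traces L|" if xV: "(x, V) \<in> ?S" for x V
  proof -
    have V: "x \<in> E" "x \<in> V" "openin X V" "V = X interior_of (cl V)" "V \<subseteq> u x"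
      using xV unfolding regular_nbhds_def by auto
    show "x \<in> E" "openin X V" "V = X interior_of (cl V)" by fact+
    show "|J V| \<le>o |T|" using u[OF V(1)] card_of_mono1[OF J_mono[OF V(5)]] ordLeq_transitive by blast
    show "trace V \<in> traces (J V)" using trace_in_traces[OF V(3,4)] .
    show "|traces (J V)| \<le>o |traces L|" using tr[OF V(1-3,5)] .
  qed
  show ?thesis
  proof (rule good_of_code)
    show "infinite ((Pow T \<times> (UNIV :: nat set)) \<times> traces L)"
    proof
      assume "finite ((Pow T \<times> (UNIV :: nat set)) \<times> traces L)"
      then have "finite (Pow T \<times> (UNIV :: nat set))" using traces_nonempty by (rule finite_cartesian_productD1)
      then show False using infinite_code_set by blast
    qed
    show "rich x ((Pow T \<times> (UNIV :: nat set)) \<times> traces L)" if "x \<in> E" for x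
      using rich_Times rich_code_set E[OF that] by blast
    show "system E ?S" using u by (intro system_regular_nbhds) blast
    show "?code x V \<in> (Pow T \<times> UNIV) \<times> traces L" if "(x, V) \<in> ?S" for x V
      using c(1)[OF S(2)[OF that]] \<phi>(2)[OF S(6)[OF that]] S(5)[OF that] by blast
    fix p
    show "noetherian_family {V. \<exists>x. (x, V) \<in> ?S \<and> ?code x V = p}"
      unfolding noetherian_family_def
    proof
      assume "\<exists>f :: nat \<Rightarrow> 'a set. (\<forall>n. f n \<in> {V. \<exists>x. (x, V) \<in> ?S \<and> ?code x V = p}) \<and> (\<forall>n. f n \<subset> f (Suc n))"
      then obtain f :: "nat \<Rightarrow> 'a set" where
        f: "\<And>n. f n \<in> {V. \<exists>x. (x, V) \<in> ?S \<and> ?code x V = p}" "\<And>n. f n \<subset> f (Suc n)" by blast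
      obtain x y where x: "(x, f 0) \<in> ?S" "?code x (f 0) = p" and y: "(y, f 1) \<in> ?S" "?code y (f 1) = p"
        using f(1)[of 0] f(1)[of 1] by blast
      have lt: "f 0 \<subset> f 1" using f(2)[of 0] by simp
      have J: "J (f 0) = J (f 1)"
        using c(2)[OF J_mono S(2)[OF y(1)]] lt x(2) y(2) by auto
      have "\<phi> (J (f 1)) (trace (f 0)) = \<phi> (J (f 1)) (trace (f 1))" using x(2) y(2) J by auto
      then have "trace (f 0) = trace (f 1)"
        using \<phi>(1)[OF S(6)[OF y(1)]] S(5)[OF x(1)] S(5)[OF y(1)] J by (simp add: inj_on_eq_iff)
      then show False
        using regular_open_determined[OF S(3,4)[OF x(1)] S(3,4)[OF y(1)] J] lt by blast
    qed
  qed
qed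

text \<open>Points are grouped into classes by the least cardinality of \<^term>\<open>traces (J V)\<close> over small
  neighbourhoods \<open>V\<close>; within a class, those not rich for that cardinality are relatively discrete.
  The colour of \<^term>\<open>J V\<close> keeps an increasing chain inside a single class.\<close>

lemma good_exact: "good {x \<in> R. locally_le T x \<and> qrich T x}" (is "good ?Z")
proof -
  define adm where "adm x V \<longleftrightarrow> openin X V \<and> x \<in> V \<and> |J V| \<le>o |T|" for x V
  have "\<exists>U. x \<in> ?Z \<longrightarrow> adm x U \<and> (\<forall>V. adm x V \<longrightarrow> |traces (J U)| \<le>o |traces (J V)| )" for x
  proof (cases "x \<in> ?Z")
    case True
    then have "{traces (J V) | V. adm x V} \<noteq> {}" unfolding locally_le_def adm_def by blast
    from minimal_card_exists[OF this] show ?thesis by blast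
  qed blast
  then have "\<exists>u. \<forall>x. x \<in> ?Z \<longrightarrow> adm x (u x) \<and> (\<forall>V. adm x V \<longrightarrow> |traces (J (u x))| \<le>o |traces (J V)| )"
    by (intro choice allI)
  then obtain u where u0: "\<forall>x. x \<in> ?Z \<longrightarrow> adm x (u x) \<and> (\<forall>V. adm x V \<longrightarrow> |traces (J (u x))| \<le>o |traces (J V)| )" ..
  have u: "adm x (u x)" "adm x V \<Longrightarrow> |traces (J (u x))| \<le>o |traces (J V)|" if "x \<in> ?Z" for x V
    using u0 that by blast+
  \<comment> \<open>A cardinal, represented by the class of all \<open>L\<close> with that many
    traces, so that cardinals can be compared by equality.\<close>
  define \<rho> where "\<rho> x = {L. |traces L| =o |traces (J (u x))| }" for x
  have \<rho>: "J V \<in> \<rho> x" if xZ: "x \<in> ?Z" and V: "x \<in> V" "openin X V" "V \<subseteq> u x" for x V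
  proof -
    have "adm x V" using u(1)[OF xZ] V card_of_mono1[OF J_mono[OF V(3)]] ordLeq_transitive
      unfolding adm_def by blast
    then show ?thesis
      unfolding \<rho>_def using u(2)[OF xZ] traces_mono[OF J_mono[OF V(3)]] ordIso_of_antisym by blast
  qed
  have \<rho>_iso: "|traces K| =o |traces L|" if "K \<in> \<rho> x" "L \<in> \<rho> x" for K L x
    using that ordIso_symmetric ordIso_transitive unfolding \<rho>_def by blast
  have \<rho>_eq: "\<rho> x = \<rho> y" if L: "L \<in> \<rho> x" "L \<in> \<rho> y" for L x y
  proof -
    have "|traces (J (u x))| =o |traces (J (u y))|"
      using L ordIso_symmetric ordIso_transitive unfolding \<rho>_def by blast
    then show ?thesis unfolding \<rho>_def using ordIso_symmetric ordIso_transitive by blast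
  qed
  have class_good: "good {x \<in> ?Z. \<rho> x = \<kappa>}" for \<kappa>
  proof (cases "{x \<in> ?Z. \<rho> x = \<kappa>} = {}")
    case True
    show ?thesis unfolding True by (rule good_discrete) simp
  next
    case False
    then obtain z where z: "z \<in> ?Z" "\<rho> z = \<kappa>" by blast
    define L where "L = J (u z)"
    have L: "L \<in> \<kappa>" unfolding L_def z(2)[symmetric] \<rho>_def by (simp add: card_of_refl)
    let ?E = "{x \<in> ?Z. \<rho> x = \<kappa> \<and> rich x (traces L)}"
    let ?N = "{x \<in> ?Z. \<rho> x = \<kappa> \<and> \<not> rich x (traces L)}"
    have "good ?E"
    proof (rule good_exact_traces_rich[where L = L and T = T and u = u])
      show "x \<in> R \<and> qrich T x \<and> rich x (traces L)" if "x \<in> ?E" for x using that by blast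
      show "openin X (u x) \<and> x \<in> u x \<and> |J (u x)| \<le>o |T|" if "x \<in> ?E" for x
        using u(1)[of x] that unfolding adm_def by blast
      show "|traces (J V)| \<le>o |traces L|" if "x \<in> ?E" "x \<in> V" "openin X V" "V \<subseteq> u x" for x V
        using \<rho>_iso[OF \<rho>, of x V L] that L ordIso_iff_ordLeq by blast
    qed
    \<comment> \<open>A second such point \<open>y\<close> near \<open>x\<close> would have a
      neighbourhood \<open>W\<close> with closure off \<open>x\<close>; an antichain in it indexed
      by \<open>traces (J W)\<close>, as large as \<open>traces L\<close>, contradicts the choice of
      \<open>U\<close>.\<close>
    moreover have "good ?N"
    proof (rule good_discrete)
      fix x assume x: "x \<in> ?N"
      then obtain U where U: "openin X U" "x \<in> U"
        and no: "\<And>H A. openin X H \<Longrightarrow> H \<subseteq> U \<Longrightarrow> x \<notin> cl H \<Longrightarrow> \<not> open_antichain H (traces L) A"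
        unfolding rich_def by blast
      have "y = x" if y: "y \<in> U" "y \<in> ?N" for y
      proof (rule ccontr)
        assume "y \<noteq> x"
        have yZ: "y \<in> ?Z" and y\<rho>: "\<rho> y = \<kappa>" using y(2) by blast+
        have "openin X (U \<inter> u y)" "y \<in> U \<inter> u y"
          using u(1)[OF yZ] U(1) y(1) unfolding adm_def by (simp_all add: openin_Int)
        moreover have "x \<in> topspace X" using x unfolding R_def by blast
        ultimately obtain W where W: "openin X W" "y \<in> W" "cl W \<subseteq> U \<inter> u y" "x \<notin> cl W"
          using separate_points[of "U \<inter> u y" y x] \<open>y \<noteq> x\<close> by blast
        have WU: "W \<subseteq> U \<inter> u y" using W(1,3) closure_of_subset[of W X] openin_subset by blast
        have "J W \<in> \<kappa>" using \<rho>[OF yZ W(2,1)] WU y\<rho> by blast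
        then have "|traces L| \<le>o |traces (J W)|" using \<rho>_iso[of L z "J W"] L z(2) ordIso_iff_ordLeq by blast
        moreover obtain A where "open_antichain W (traces (J W)) A" using traces_antichain[OF W(1)] .
        ultimately obtain A' where "open_antichain W (traces L) A'" using open_antichain_ordLeq by blast
        then show False using no[OF W(1) _ W(4)] WU by blast
      qed
      then show "\<exists>U. openin X U \<and> U \<inter> ?N = {x}" using U x by blast
    qed
    ultimately have "good (?E \<union> ?N)" by (rule good_Un)
    then show ?thesis by (rule good_subset) blast
  qed
  have "\<exists>S. \<forall>\<kappa>. system {x \<in> ?Z. \<rho> x = \<kappa>} (S \<kappa>) \<and> noetherian_family (snd ` S \<kappa>)"
    using class_good unfolding good_def by (intro choice allI)
  then obtain S0 where S0: "\<forall>\<kappa>. system {x \<in> ?Z. \<rho> x = \<kappa>} (S0 \<kappa>) \<and> noetherian_family (snd ` S0 \<kappa>)" ..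
  have sys: "system {x \<in> ?Z. \<rho> x = \<kappa>} (S0 \<kappa>)" and noeth: "noetherian_family (snd ` S0 \<kappa>)" for \<kappa>
    using S0 by blast+
  define S where "S = {(x, V). x \<in> ?Z \<and> (x, V) \<in> S0 (\<rho> x) \<and> V \<subseteq> u x}"
  have S: "x \<in> ?Z" "(x, V) \<in> S0 (\<rho> x)" "x \<in> V" "openin X V" "V \<subseteq> u x" if "(x, V) \<in> S" for x V
    using that systemD(2,3)[OF sys] unfolding S_def by blast+
  have J\<rho>: "J V \<in> \<rho> x" "|J V| \<le>o |T|" if xV: "(x, V) \<in> S" for x V
  proof -
    show "J V \<in> \<rho> x" using \<rho>[OF S(1,3-5)[OF xV]] .
    show "|J V| \<le>o |T|"
      using u(1)[OF S(1)[OF xV]] card_of_mono1[OF J_mono[OF S(5)[OF xV]]] ordLeq_transitive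
      unfolding adm_def by blast
  qed
  obtain c :: "'a set \<Rightarrow> 'a set \<times> nat" where c: "\<And>A. |A| \<le>o |T| \<Longrightarrow> c A \<in> Pow T \<times> UNIV"
    "\<And>A B. A \<subseteq> B \<Longrightarrow> |B| \<le>o |T| \<Longrightarrow> c A = c B \<Longrightarrow> A = B"
    using antichain_colouring[where ?'b = 'a and T = T] by metis
  show ?thesis
  proof (rule good_of_code)
    show "infinite (Pow T \<times> (UNIV :: nat set))" by (rule infinite_code_set)
    show "rich x (Pow T \<times> (UNIV :: nat set))" if "x \<in> ?Z" for x using that rich_code_set by blast
    show "system ?Z S"
    proof (rule systemI)
      show "x \<in> ?Z \<and> x \<in> V \<and> openin X V" if "(x, V) \<in> S" for x V using S(1,3,4)[OF that] by blast
      fix x U assume x: "x \<in> ?Z" and U: "openin X U" "x \<in> U"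
      have "openin X (U \<inter> u x)" "x \<in> U \<inter> u x"
        using U u(1)[OF x] unfolding adm_def by (simp_all add: openin_Int)
      then obtain V where "(x, V) \<in> S0 (\<rho> x)" "V \<subseteq> U \<inter> u x"
        using systemD(4)[OF sys[of "\<rho> x"], of x "U \<inter> u x"] x by blast
      then show "\<exists>V. (x, V) \<in> S \<and> V \<subseteq> U" using x unfolding S_def by blast
    qed
    show "c (J V) \<in> Pow T \<times> UNIV" if "(x, V) \<in> S" for x V using c(1)[OF J\<rho>(2)[OF that]] .
    fix p
    show "noetherian_family {V. \<exists>x. (x, V) \<in> S \<and> c (J V) = p}"
      unfolding noetherian_family_def
    proof
      assume "\<exists>f :: nat \<Rightarrow> 'a set. (\<forall>n. f n \<in> {V. \<exists>x. (x, V) \<in> S \<and> c (J V) = p}) \<and> (\<forall>n. f n \<subset> f (Suc n))"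
      then obtain f :: "nat \<Rightarrow> 'a set" where
        f: "\<And>n. \<exists>x. (x, f n) \<in> S \<and> c (J (f n)) = p" "\<And>n. f n \<subset> f (Suc n)" by blast
      obtain z where z: "(z, f 0) \<in> S" "c (J (f 0)) = p" using f(1) by blast
      have "f n \<in> snd ` S0 (\<rho> z)" for n
      proof -
        obtain x where x: "(x, f n) \<in> S" "c (J (f n)) = p" using f(1) by blast
        have "f 0 \<subseteq> f n" using lift_Suc_mono_le[of f 0 n] f(2) by blast
        then have "J (f 0) = J (f n)" using c(2)[OF J_mono J\<rho>(2)[OF x(1)]] x(2) z(2) by simp
        then have "\<rho> x = \<rho> z" using \<rho>_eq[OF J\<rho>(1)[OF x(1)]] J\<rho>(1)[OF z(1)] by simp
        then show ?thesis using S(2)[OF x(1)] by force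
      qed
      then show False using noeth[of "\<rho> z"] f(2) unfolding noetherian_family_def by blast
    qed
  qed
qed


text \<open>Not being strongly inaccessible makes the smaller cardinals of an uncountable \<^term>\<open>T\<close> cofinal
  along at most \<^term>\<open>|Pow S|\<close> many of them, for some smaller \<^term>\<open>S\<close>.\<close>

lemma not_inaccessible_cofinal:
  assumes "\<not> countable T" "\<not> strongly_inaccessible_card T"
  obtains S C where "S \<subseteq> T" "|S| <o |T|" "C \<subseteq> T" "|C| \<le>o |Pow S|"
    "\<And>A :: 'b set. |A| <o |T| \<Longrightarrow> \<exists>c\<in>C. |A| \<le>o |underS |T| c|"
proof (cases "regularCard |T|")
  case True
  then obtain S where S: "S \<subseteq> T" "|S| <o |T|" "\<not> |Pow S| <o |T|"
    using assms unfolding strongly_inaccessible_card_def by blast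
  \<comment> \<open>Regular but not a strong limit: all of \<open>T\<close> serves as the index set
    \<open>C\<close>.\<close>
  have "|T| \<le>o |Pow S|" using S(3) card_less_or_le by blast
  moreover have "\<exists>c\<in>T. |A| \<le>o |underS |T| c|" if "|A| <o |T|" for A :: "'b set"
    using card_less_iso_underS[OF that] ordIso_iff_ordLeq by metis
  ultimately show thesis using that[OF S(1,2) subset_refl] by blast
next
  case False
  then obtain K where K: "K \<subseteq> T" "cofinal K |T|" "\<not> |K| =o |T|"
    unfolding regularCard_def by (auto simp: Field_card_of)
  have "|K| \<le>o |T|" using K(1) by (rule card_of_mono1)
  then have less: "|K| <o |T|" using K(3) card_less_or_le ordIso_of_antisym by blast
  \<comment> \<open>Singular: the cofinal set \<open>K\<close> serves both as \<open>S\<close> and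
    as \<open>C\<close>.\<close>
  have "|K| \<le>o |Pow K|" using card_of_Pow ordLess_imp_ordLeq by blast
  moreover have "\<exists>c\<in>K. |A| \<le>o |underS |T| c|" if A: "|A| <o |T|" for A :: "'b set"
  proof -
    obtain a where a: "a \<in> T" "|A| =o |underS |T| a|" using card_less_iso_underS[OF A] .
    then obtain b where b: "b \<in> K" "(a, b) \<in> |T|"
      using K(2) unfolding cofinal_def by (auto simp: Field_card_of)
    have "trans |T|" "antisym |T|" using card_of_Well_order[of T]
      by (simp_all add: well_order_on_def linear_order_on_def partial_order_on_def preorder_on_def)
    then have "underS |T| a \<subseteq> underS |T| b" using b(2) by (rule underS_incr)
    then have "|A| \<le>o |underS |T| b|"
      using a(2) card_of_mono1 ordIso_ordLeq_trans by blast
    then show ?thesis using b(1) by blast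
  qed
  ultimately show thesis using that[OF K(1) less K(1)] by blast
qed

text \<open>The smaller sets are finite, so sorting them by the number \<open>card S\<close> gives
  countably many good pieces, and points of \<open>R\<close> are rich for that many.\<close>

lemma good_smaller_countable:
  fixes T :: "'a set"
  assumes T: "countable T"
    and IH: "\<And>S. S \<subseteq> topspace X \<Longrightarrow> |S| <o |T| \<Longrightarrow> good {x \<in> R. small S x}"
  shows "good {x \<in> R. \<exists>S\<subseteq>topspace X. |S| <o |T| \<and> small S x}"
proof (rule good_UN)
  define Z where "Z n = {x \<in> R. \<exists>S\<subseteq>topspace X. finite S \<and> card S = n \<and> |S| <o |T| \<and> small S x}" for n
  show "infinite (UNIV :: nat set)" by simp
  show "rich x (UNIV :: nat set)" if "x \<in> {x \<in> R. \<exists>S\<subseteq>topspace X. |S| <o |T| \<and> small S x}" for x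
    using that unfolding R_def by blast
  have fin: "finite S" if S: "|S| <o |T|" for S :: "'a set"
  proof (rule ccontr)
    assume "infinite S"
    obtain f :: "'a \<Rightarrow> nat" where "inj_on f T" using T unfolding countable_def by blast
    then have "|T| \<le>o |UNIV :: nat set|" using card_of_ordLeq[of T "UNIV :: nat set"] by blast
    moreover have "|UNIV :: nat set| \<le>o |S|" using \<open>infinite S\<close> infinite_iff_card_of_nat by blast
    ultimately have "|T| \<le>o |S|" by (rule ordLeq_transitive)
    then show False using S not_ordLess_ordLeq by blast
  qed
  show "{x \<in> R. \<exists>S\<subseteq>topspace X. |S| <o |T| \<and> small S x} \<subseteq> (\<Union>n\<in>UNIV. Z n)"
    using fin unfolding Z_def by blast
  show "good (Z n)" for n
  proof (cases "\<exists>S\<subseteq>topspace X. finite S \<and> card S = n \<and> |S| <o |T|")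
    case True
    then obtain S where S: "S \<subseteq> topspace X" "finite S" "card S = n" "|S| <o |T|" by blast
    have "small S x" if "finite S'" "card S' = n" "small S' x" for S' x
    proof -
      have "\<exists>h. bij_betw h S' S" using that(1,2) S(2,3) by (intro finite_same_card_bij) simp_all
      then have "|S'| =o |S|" using card_of_ordIso by blast
      then show ?thesis using small_mono[OF that(3)] ordIso_iff_ordLeq by blast
    qed
    then have "Z n \<subseteq> {x \<in> R. small S x}" unfolding Z_def by blast
    then show ?thesis using good_subset[OF IH[OF S(1,4)]] by blast
  next
    case False
    then have "Z n = {}" unfolding Z_def by blast
    then show ?thesis using good_discrete[of "{}"] by simp
  qed
qed

text \<open>Points small for \<open>S\<close> form a good set by induction. The others are
  \<open>qrich S\<close>, and cofinality puts each into one of at most \<open>|Pow S|\<close> sets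
  that are good by induction, so \<open>good_UN\<close> applies.\<close>

lemma good_smaller_uncountable:
  fixes T :: "'a set"
  assumes T: "\<not> countable T" "\<not> strongly_inaccessible_card T" "T \<subseteq> topspace X"
    and IH: "\<And>S. S \<subseteq> topspace X \<Longrightarrow> |S| <o |T| \<Longrightarrow> good {x \<in> R. small S x}"
  shows "good {x \<in> R. \<exists>S\<subseteq>topspace X. |S| <o |T| \<and> small S x}" (is "good ?Y")
proof -
  obtain S C where SC: "S \<subseteq> T" "|S| <o |T|" "C \<subseteq> T" "|C| \<le>o |Pow S|"
    "\<And>A :: 'a set. |A| <o |T| \<Longrightarrow> \<exists>c\<in>C. |A| \<le>o |underS |T| c|"
    using not_inaccessible_cofinal[OF T(1,2), where ?'b = 'a] by metis
  have "good {x \<in> R. small S x}" using IH SC(1,2) T(3) by blast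
  moreover have "good {x \<in> ?Y. \<not> small S x}"
  proof -
    let ?Q = "Pow S \<times> (UNIV :: nat set)"
    obtain g where g: "inj_on g C" "g ` C \<subseteq> Pow S" using SC(4) by (rule card_le_injE)
    define Z where "Z q = {x \<in> R. \<exists>c\<in>C. (g c, 0) = q \<and> small (underS |T| c) x}" for q :: "'a set \<times> nat"
    show ?thesis
    proof (rule good_UN)
      show "infinite ?Q" by (rule infinite_code_set)
      show "rich x ?Q" if "x \<in> {x \<in> ?Y. \<not> small S x}" for x
        using that rich_code_set unfolding small_def by blast
      show "{x \<in> ?Y. \<not> small S x} \<subseteq> (\<Union>q\<in>?Q. Z q)"
      proof
        fix x assume "x \<in> {x \<in> ?Y. \<not> small S x}"
        then obtain A where A: "x \<in> R" "|A| <o |T|" "small A x" by blast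
        obtain c where c: "c \<in> C" "|A| \<le>o |underS |T| c|" using SC(5)[OF A(2)] by blast
        have "x \<in> Z (g c, 0)" using small_mono[OF A(3) c(2)] A(1) c(1) unfolding Z_def by blast
        moreover have "(g c, 0) \<in> ?Q" using g(2) c(1) by blast
        ultimately show "x \<in> (\<Union>q\<in>?Q. Z q)" by blast
      qed
      show "good (Z q)" for q
      proof (cases "\<exists>c\<in>C. (g c, 0) = q")
        case True
        then obtain c where c: "c \<in> C" "(g c, 0) = q" by blast
        have cT: "c \<in> T" using c(1) SC(3) by blast
        have "underS |T| c \<subseteq> T" using Field_card_of[of T] by (auto simp: underS_def Field_def)
        then have "good {x \<in> R. small (underS |T| c) x}" using IH card_underS_card_of[OF cT] T(3) by blast
        moreover have "Z q \<subseteq> {x \<in> R. small (underS |T| c) x}"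
          using c inj_onD[OF g(1)] unfolding Z_def by blast
        ultimately show ?thesis by (rule good_subset)
      next
        case False
        then have "Z q = {}" unfolding Z_def by blast
        then show ?thesis using good_discrete[of "{}"] by simp
      qed
    qed
  qed
  ultimately have "good ({x \<in> R. small S x} \<union> {x \<in> ?Y. \<not> small S x})" by (rule good_Un)
  then show ?thesis by (rule good_subset) blast
qed

text \<open>A point small for \<open>T\<close> is small for a set of smaller cardinality, or else
  fails \<open>qrich T\<close>, or is \<open>qrich T\<close> with a neighbourhood that meets at most
  \<open>|T|\<close> cells.\<close>

theorem good_small:
  assumes inacc: "\<And>A. A \<subseteq> topspace X \<Longrightarrow> \<not> strongly_inaccessible_card A"
  shows "T \<subseteq> topspace X \<Longrightarrow> good {x \<in> R. small T x}"
proof (induction T rule: wf_induct_rule[OF wf_inv_image[OF wf_ordLess, of card_of]])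
  case (1 T)
  have IH: "good {x \<in> R. small S x}" if "S \<subseteq> topspace X" "|S| <o |T|" for S
    using "1.IH"[of S] that by (simp add: inv_image_def)
  let ?L = "{x \<in> R. \<exists>S\<subseteq>topspace X. |S| <o |T| \<and> small S x}"
  let ?N = "{x \<in> R. \<not> qrich T x \<and> (\<forall>S\<subseteq>topspace X. |S| <o |T| \<longrightarrow> \<not> small S x)}"
  let ?Z = "{x \<in> R. locally_le T x \<and> qrich T x}"
  have "good ?L"
    using good_smaller_countable[OF _ IH] good_smaller_uncountable[OF _ inacc[OF 1(2)] 1(2) IH] by blast
  then have "good (?L \<union> ?N \<union> ?Z)" using good_not_qrich good_exact by (intro good_Un)
  moreover have "{x \<in> R. small T x} \<subseteq> ?L \<union> ?N \<union> ?Z" unfolding small_def by blast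
  ultimately show ?case by (rule good_subset)
qed

text \<open>The whole space is a neighbourhood that meets at most \<open>|D|\<close> cells, so every
  point of \<open>R\<close> is small for \<open>D\<close>.\<close>

lemma good_topspace:
  assumes "\<And>A. A \<subseteq> topspace X \<Longrightarrow> \<not> strongly_inaccessible_card A"
  shows "good (topspace X)"
proof -
  have "small D x" if "x \<in> R" for x
    using that card_of_mono1[OF J_subset, of "topspace X"] openin_topspace[of X]
    unfolding small_def locally_le_def R_def by blast
  then have "good R" using good_small[OF assms D_subset] by (rule_tac good_subset) auto
  then have "good (R \<union> (topspace X - R))" using good_non_R by (rule good_Un)
  then show ?thesis by (rule good_subset) blast
qed

end

theorem theorem1:
  fixes X :: "'a topology"
  assumes "T3_space X"
    and "\<not> (\<exists>A\<subseteq>topspace X. strongly_inaccessible_card A)"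
  shows "\<exists>\<B>. noetherian_base X \<B>"
proof -
  interpret t3 X using assms(1) by unfold_locales (auto simp: T3_space_def)
  obtain D G P where "t3_cells X D G P" using cells_exist by blast
  then interpret t3_cells X D G P .
  show ?thesis using good_topspace assms(2) by (intro noetherian_base_of_good) blast
qed

end
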